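(* Suppose that the Bayesian game described in the context satisfies: (a) Assumptions A, B, C and D stated there; (b) for each $i\in N$, $\phi_i(a_i,f_{-i},\theta_i)$ is weakly quasi-supermodular in $a_i$ over $\mathcal A_i$ for all $f_{-i}\in\mathcal F_{-i}$ and $\theta_i\in\Theta_i$, and is weak single-crossing in $(a_i,f_{-i})$ over $\mathcal A_i\times\mathcal F_{-i}$ for all $\theta_i\in\Theta_i$. Then the following assertions hold. (i) The game has a greatest Bayesian Nash equilibrium (BNE) and a least BNE (with respect to the order $\succeq$ on $\mathcal F$), with all players' equilibrium strategy functions being uniformly Lipschitz continuous (i.e. Lipschitz continuous on $\Theta_i$, $i\in N$, with a common modulus). (ii) If, in addition, for each $i\in N$, $\phi_i(a_i,f_{-i},\theta_i)$ is weak single-crossing in $(a_i,\theta_i)$ over $\mathcal A_i\times\Theta_i$ for all $f_{-i}\in\mathcal F_{-i}^+$, then the greatest and the least Lipschitz continuous BNEs are monotone (each player's strategy function is increasing in its own type). (iii) Furthermore (under the hypotheses of (i) and (ii)), if the nonnegative matrix $M=[M_{ij}]_{i,j=1}^n$ with $M_{ii}:=0$ and $M_{ij}:=\tau_{ij}/\sigma_i$ for $i\ne j$ has spectral radius $\rho(M)<1$, then the greatest and least Lipschitz continuous and monotone BNEs coincide, hence the equilibrium is unique.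
   Context: Bayesian game. $N=\{1,\dots,n\}$ is the set of players. For $i\in N$, the type set $\Theta_i\subset\mathbb R^{d_i}$ and the action set $\mathcal A_i\subset\mathbb R^{z_i}$ are non-empty, compact and convex. $\Theta=\prod_i\Theta_i$, $\mathcal A=\prod_i\mathcal A_i$, and the subscript $-i$ denotes the product/vector over all players except $i$. Player $i$'s utility is $u_i(a_i,a_{-i},\theta)$, $a=(a_i,a_{-i})\in\mathcal A$, $\theta=(\theta_i,\theta_{-i})\in\Theta$. The type profile $\theta$ has a prior distribution $\eta$, a Borel probability measure on $\Theta$ with full support; $\eta_i$ denotes its marginal on $\Theta_i$, and $\eta_i(\cdot\mid\theta_i)$ the conditional distribution of $\theta_{-i}$ given $\theta_i$, a probability measure on $\Theta_{-i}$ specified for every $\theta_i\in\Theta_i$. Norms of vectors are Euclidean. Strategies. $\mathcal F_i$ is the set of measurable functions $f_i:\Theta_i\to\mathcal A_i$; $\mathcal F_i^+\subset\mathcal F_i$ is the subset of increasing functions ($\theta_i\ge\theta_i'\Rightarrow f_i(\theta_i)\ge f_i(\theta_i')$); $\mathcal F=\prod_i\mathcal F_i$, $\mathcal F_{-i}=\prod_{j\neq i}\mathcal F_j$, $\mathcal F^+_{-i}=\prod_{j\ne i}\mathcal F_j^+$. The expected utility is $\phi_i(a_i,f_{-i},\theta_i)=\int_{\Theta_{-i}}u_i(a_i,f_{-i}(\theta_{-i}),\theta_i,\theta_{-i})\,d\eta_i(\theta_{-i}\mid\theta_i)$. A BNE is an $f^*\in\mathcal F$ with $f_i^*(\theta_i)\in\arg\max_{a_i\in\mathcal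 A_i}\phi_i(a_i,f^*_{-i},\theta_i)$ for all $\theta_i\in\Theta_i$ and all $i\in N$. Orders. Vectors are ordered componentwise, with $\vee,\wedge$ the componentwise maximum and minimum. For $f_i,g_i\in\mathcal F_i$, $f_i\succeq g_i$ means $f_i(\theta_i)\ge g_i(\theta_i)$ for all $\theta_i\in\Theta_i$; $\mathcal F_{-i}$ and $\mathcal F$ carry the product orders (also denoted $\succeq$). For a lattice $S$, $f:S\to\mathbb R$ is weakly quasi-supermodular if $f(x')\ge f(x'\wedge x)$ implies $f(x'\vee x)\ge f(x)$ for all $x,x'\in S$. For a partially ordered set $T$, $g:S\times T\to\mathbb R$ is weak single-crossing over $S\times T$ if for all $x'\ge x$ in $S$ and $t'\ge t$ in $T$, $g(x',t)\ge g(x,t)$ implies $g(x',t')\ge g(x,t')$. Assumption A. For each $i\in N$: (a) $u_i(a,\theta)$ is continuous in $(a,\theta)$, and $\nabla_{a_i}u_i(a,\theta)$ is continuous in $a$ and measurable in $\theta$; (b) for each $\hat a_i\in\mathcal A_i$, $f_{-i}\in\mathcal F_{-i}$ and $\theta_i\in\Theta_i$ there exist a neighborhood $\mathcal U_i(\hat a_i;f_{-i},\theta_i)$ of $\hat a_i$ relative to $\mathcal A_i$ and a nonnegative function $h_{\hat a_i,f_{-i}}:\Theta_i\times\Theta_{-i}\to\mathbb R_+$ with $h_{\hat a_i,f_{-i}}(\theta_i,\cdot)\in\mathcal L^1(\eta_i(\cdot\mid\theta_i))$ such that $\sup_{a_i\in\mathcal U_i(\hat a_i;f_{-i},\theta_i)}\|\nabla_{a_i}u_i(a_i,f_{-i}(\theta_{-i}),\theta_i,\theta_{-i})\|\le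 h_{\hat a_i,f_{-i}}(\theta_i,\theta_{-i})$ for all $\theta_{-i}\in\Theta_{-i}$ (the function $h_{\hat a_i,f_{-i}}$ depends only on $\hat a_i,f_{-i}$, the neighborhood may depend on $\theta_i$ too); (c) for every Borel set $S\subset\Theta_{-i}$, $\eta_i(S\mid\cdot)$ is measurable on $\Theta_i$. Assumption B. For each $i\in N$: (a) there is a constant $\sigma_i>0$ such that $(\nabla_{a_i}u_i(a_i',a_{-i},\theta)-\nabla_{a_i}u_i(a_i'',a_{-i},\theta))^\top(a_i'-a_i'')\le-\sigma_i\|a_i'-a_i''\|^2$ for all $a_i',a_i''\in\mathcal A_i$, $a_{-i}\in\mathcal A_{-i}$, $\theta\in\Theta$; (b) there are constants $\tau_{ij}\ge 0$, $j\ne i$, such that $\|\nabla_{a_i}u_i(a_i,a_{-i}',\theta)-\nabla_{a_i}u_i(a_i,a_{-i}'',\theta)\|\le\sum_{j\ne i}\tau_{ij}\|a_j'-a_j''\|$ for all $a_{-i}',a_{-i}''\in\mathcal A_{-i}$, $a_i\in\mathcal A_i$, $\theta\in\Theta$. Assumption C. For each $i\in N$: (a) $\sup_{a\in\mathcal A,\theta\in\Theta}\|\nabla_{a_i}u_i(a,\theta)\|<+\infty$; (b) there is a nonnegative measurable function $\nu_i:\Theta_{-i}\to\mathbb R_+$ such that $\|\nabla_{a_i}u_i(a,\theta_i',\theta_{-i})-\nabla_{a_i}u_i(a,\theta_i'',\theta_{-i})\|\le\nu_i(\theta_{-i})\|\theta_i'-\theta_i''\|$ for all $a\in\mathcal A$,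 $\theta_i',\theta_i''\in\Theta_i$, $\theta_{-i}\in\Theta_{-i}$, and $\overline\nu_i:=\sup_{\theta_i\in\Theta_i}\int_{\Theta_{-i}}\nu_i(\theta_{-i})\,d\eta_i(\theta_{-i}\mid\theta_i)<+\infty$; (c) there is $\gamma_i>0$ with $\mathsf d_{\mathrm{TV}}(\eta_i(\cdot\mid\theta_i'),\eta_i(\cdot\mid\theta_i''))\le\gamma_i\|\theta_i'-\theta_i''\|$ for all $\theta_i',\theta_i''\in\Theta_i$, where $\mathsf d_{\mathrm{TV}}(\mu,\nu)=\frac12\sup\{|\int h\,d\mu-\int h\,d\nu|: h\text{ measurable real-valued},\ \|h\|_\infty\le1\}$. Assumption D. For each $i\in N$, $\mathcal A_i$ is a sublattice of $\mathbb R^{z_i}$ (closed under componentwise maximum and minimum). *)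

theory Defs
  imports
    "HOL-Probability.Probability"
    "Jordan_Normal_Form.Spectral_Radius"
begin

text \<open>
  Players are the indices \<open>i < nplayers G\<close>. Player-dependent dimensions are rendered inside two common
  spaces: the type space of player \<open>i\<close> lies in the coordinate subspace spanned by \<open>tcoords G i\<close>
  (so its dimension \<open>d_i\<close> is the cardinality of \<open>tcoords G i\<close>), the action set in the one spanned by
  \<open>acoords G i\<close>. Norm, order and lattice operations of \<open>real ^ 'k\<close> restrict to those of the subspace.

  A profile over a set \<open>I\<close> of players is an extensional function on \<open>I\<close>, hence \<open>(x_i, x_{-i})\<close> is
  \<open>x_{-i}(i := x_i)\<close>. The topology of profiles is the product topology of the function space.
  The field \<open>cond\<close> holds the conditional distributions: \<open>cond G i t\<close> is the law of
  \<open>\<theta>_{-i}\<close> given \<open>\<theta>_i = t\<close>.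
\<close>

record ('d, 'z) bayesian_game =
  nplayers :: nat
  tcoords :: "nat \<Rightarrow> 'd set"
  acoords :: "nat \<Rightarrow> 'z set"
  typs :: "nat \<Rightarrow> (real ^ 'd) set"
  acts :: "nat \<Rightarrow> (real ^ 'z) set"
  util :: "nat \<Rightarrow> (nat \<Rightarrow> real ^ 'z) \<Rightarrow> (nat \<Rightarrow> real ^ 'd) \<Rightarrow> real"
  prior :: "(nat \<Rightarrow> real ^ 'd) measure"
  cond :: "nat \<Rightarrow> real ^ 'd \<Rightarrow> (nat \<Rightarrow> real ^ 'd) measure"

definition players :: "('d::finite, 'z::finite) bayesian_game \<Rightarrow> nat set" where
  "players G = {..<nplayers G}"

definition others :: "('d::finite, 'z::finite) bayesian_game \<Rightarrow> nat \<Rightarrow> nat set" where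
  "others G i = players G - {i}"

definition type_profiles :: "('d::finite, 'z::finite) bayesian_game \<Rightarrow> (nat \<Rightarrow> real ^ 'd) set" where
  "type_profiles G = PiE (players G) (typs G)"

definition other_types :: "('d::finite, 'z::finite) bayesian_game \<Rightarrow> nat \<Rightarrow> (nat \<Rightarrow> real ^ 'd) set" where
  "other_types G i = PiE (others G i) (typs G)"

definition act_profiles :: "('d::finite, 'z::finite) bayesian_game \<Rightarrow> (nat \<Rightarrow> real ^ 'z) set" where
  "act_profiles G = PiE (players G) (acts G)"

definition other_acts :: "('d::finite, 'z::finite) bayesian_game \<Rightarrow> nat \<Rightarrow> (nat \<Rightarrow> real ^ 'z) set" where
  "other_acts G i = PiE (others G i) (acts G)"

abbreviation borel_on :: "'a::topological_space set \<Rightarrow> 'a measure" where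
  "borel_on S \<equiv> restrict_space borel S"

definition coord_space :: "'k::finite set \<Rightarrow> (real ^ 'k) set" where
  "coord_space K = {x. \<forall>k. k \<notin> K \<longrightarrow> vec_nth x k = 0}"

definition marginal :: "('d::finite, 'z::finite) bayesian_game \<Rightarrow> nat \<Rightarrow> (real ^ 'd) measure" where
  "marginal G i = distr (prior G) (borel_on (typs G i)) (\<lambda>\<theta>. \<theta> i)"

text \<open>The last conjunct says that \<open>cond G i\<close> disintegrates the prior over the marginal on
  player \<open>i\<close>'s types.\<close>

definition is_bayesian_game :: "('d::finite, 'z::finite) bayesian_game \<Rightarrow> bool" where
  "is_bayesian_game G \<longleftrightarrow>
     nplayers G \<ge> 1 \<and>
     (\<forall>i\<in>players G.
        typs G i \<subseteq> coord_space (tcoords G i) \<and>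
        typs G i \<noteq> {} \<and> compact (typs G i) \<and> convex (typs G i) \<and>
        acts G i \<subseteq> coord_space (acoords G i) \<and>
        acts G i \<noteq> {} \<and> compact (acts G i) \<and> convex (acts G i)) \<and>
     prob_space (prior G) \<and>
     sets (prior G) = sets (borel_on (type_profiles G)) \<and>
     (\<forall>U. openin (top_of_set (type_profiles G)) U \<and> U \<noteq> {} \<longrightarrow> emeasure (prior G) U > 0) \<and>
     (\<forall>i\<in>players G. \<forall>t\<in>typs G i.
        prob_space (cond G i t) \<and> sets (cond G i t) = sets (borel_on (other_types G i))) \<and>
     (\<forall>i\<in>players G. \<forall>B\<in>sets (borel_on (typs G i)). \<forall>S\<in>sets (borel_on (other_types G i)).
        emeasure (prior G) {\<theta> \<in> type_profiles G. \<theta> i \<in> B \<and> restrict \<theta> (others G i) \<in> S} =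
        (\<integral>\<^sup>+ t \<in> B. emeasure (cond G i t) S \<partial>marginal G i))"

text \<open>Strategies are extensional as well, so that equality of strategy profiles is equality on the
  type sets, and the pointwise order \<open>\<le>\<close> of HOL functions is exactly the product order on strategy
  profiles (see \<open>strategy_profiles_le_iff\<close> below).\<close>

definition strategies :: "('d::finite, 'z::finite) bayesian_game \<Rightarrow> nat \<Rightarrow> (real ^ 'd \<Rightarrow> real ^ 'z) set" where
  "strategies G i =
     extensional (typs G i) \<inter> measurable (borel_on (typs G i)) (borel_on (acts G i))"

definition incr_strategies :: "('d::finite, 'z::finite) bayesian_game \<Rightarrow> nat \<Rightarrow> (real ^ 'd \<Rightarrow> real ^ 'z) set" where
  "incr_strategies G i = {f \<in> strategies G i. mono_on (typs G i) f}"

definition strategy_profiles ::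
    "('d::finite, 'z::finite) bayesian_game \<Rightarrow> (nat \<Rightarrow> real ^ 'd \<Rightarrow> real ^ 'z) set" where
  "strategy_profiles G = PiE (players G) (strategies G)"

definition other_strategies ::
    "('d::finite, 'z::finite) bayesian_game \<Rightarrow> nat \<Rightarrow> (nat \<Rightarrow> real ^ 'd \<Rightarrow> real ^ 'z) set" where
  "other_strategies G i = PiE (others G i) (strategies G)"

definition other_incr_strategies ::
    "('d::finite, 'z::finite) bayesian_game \<Rightarrow> nat \<Rightarrow> (nat \<Rightarrow> real ^ 'd \<Rightarrow> real ^ 'z) set" where
  "other_incr_strategies G i = PiE (others G i) (incr_strategies G)"

lemma strategy_profiles_le_iff:
  assumes "f \<in> strategy_profiles G" "g \<in> strategy_profiles G"
  shows "f \<le> g \<longleftrightarrow> (\<forall>i\<in>players G. \<forall>t\<in>typs G i. f i t \<le> g i t)"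
proof
  assume R: "\<forall>i\<in>players G. \<forall>t\<in>typs G i. f i t \<le> g i t"
  have "f i t \<le> g i t" for i t
  proof (cases "i \<in> players G")
    case True
    with assms have "f i \<in> extensional (typs G i)" "g i \<in> extensional (typs G i)"
      by (auto simp: strategy_profiles_def strategies_def PiE_iff)
    with R True show ?thesis
      by (cases "t \<in> typs G i") (auto simp: extensional_def)
  next
    case False
    with assms show ?thesis
      by (auto simp: strategy_profiles_def PiE_iff extensional_def)
  qed
  then show "f \<le> g" by (simp add: le_fun_def)
qed (auto simp: le_fun_def)

definition play_others ::
    "('d::finite, 'z::finite) bayesian_game \<Rightarrow> nat \<Rightarrow> (nat \<Rightarrow> real ^ 'd \<Rightarrow> real ^ 'z)
      \<Rightarrow> (nat \<Rightarrow> real ^ 'd) \<Rightarrow> nat \<Rightarrow> real ^ 'z" where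
  "play_others G i f \<theta> = (\<lambda>j\<in>others G i. f j (\<theta> j))"

definition exp_util ::
    "('d::finite, 'z::finite) bayesian_game \<Rightarrow> nat \<Rightarrow> real ^ 'z
      \<Rightarrow> (nat \<Rightarrow> real ^ 'd \<Rightarrow> real ^ 'z) \<Rightarrow> real ^ 'd \<Rightarrow> real" where
  "exp_util G i x f t =
     (\<integral>\<theta>. util G i ((play_others G i f \<theta>)(i := x)) (\<theta>(i := t)) \<partial>cond G i t)"

definition BNE :: "('d::finite, 'z::finite) bayesian_game \<Rightarrow> (nat \<Rightarrow> real ^ 'd \<Rightarrow> real ^ 'z) set" where
  "BNE G = {f \<in> strategy_profiles G. \<forall>i\<in>players G. \<forall>t\<in>typs G i.
     is_arg_max (\<lambda>x. exp_util G i x (restrict f (others G i)) t) (\<lambda>x. x \<in> acts G i) (f i t)}"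

definition greatest_in :: "'a::order set \<Rightarrow> 'a \<Rightarrow> bool" where
  "greatest_in S x \<longleftrightarrow> x \<in> S \<and> (\<forall>y\<in>S. y \<le> x)"

definition least_in :: "'a::order set \<Rightarrow> 'a \<Rightarrow> bool" where
  "least_in S x \<longleftrightarrow> x \<in> S \<and> (\<forall>y\<in>S. x \<le> y)"

definition weakly_quasi_supermodular :: "'a::lattice set \<Rightarrow> ('a \<Rightarrow> real) \<Rightarrow> bool" where
  "weakly_quasi_supermodular S f \<longleftrightarrow>
     (\<forall>x\<in>S. \<forall>x'\<in>S. f x' \<ge> f (inf x' x) \<longrightarrow> f (sup x' x) \<ge> f x)"

definition weak_single_crossing ::
    "'a::order set \<Rightarrow> 'b::order set \<Rightarrow> ('a \<Rightarrow> 'b \<Rightarrow> real) \<Rightarrow> bool" where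
  "weak_single_crossing S T g \<longleftrightarrow>
     (\<forall>x\<in>S. \<forall>x'\<in>S. \<forall>t\<in>T. \<forall>t'\<in>T.
        x' \<ge> x \<and> t' \<ge> t \<and> g x' t \<ge> g x t \<longrightarrow> g x' t' \<ge> g x t')"

definition own_type_single_crossing :: "('d::finite, 'z::finite) bayesian_game \<Rightarrow> bool" where
  "own_type_single_crossing G \<longleftrightarrow>
     (\<forall>i\<in>players G. \<forall>f\<in>other_incr_strategies G i.
        weak_single_crossing (acts G i) (typs G i) (\<lambda>x t. exp_util G i x f t))"

text \<open>\<open>D i a \<theta>\<close> plays the role of the partial gradient of player \<open>i\<close>'s utility in the own action. It is
  a parameter because the derivative relative to \<open>acts G i\<close> determines the gradient uniquely
  only if \<open>acts G i\<close> spans its coordinate space affinely; otherwise any choice of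
  gradient, e.g. that of an extension of the utility to a neighbourhood, is admitted.\<close>

definition own_gradient ::
    "('d::finite, 'z::finite) bayesian_game
      \<Rightarrow> (nat \<Rightarrow> (nat \<Rightarrow> real ^ 'z) \<Rightarrow> (nat \<Rightarrow> real ^ 'd) \<Rightarrow> real ^ 'z) \<Rightarrow> bool" where
  "own_gradient G D \<longleftrightarrow>
     (\<forall>i\<in>players G. \<forall>a\<in>act_profiles G. \<forall>\<theta>\<in>type_profiles G.
        D i a \<theta> \<in> coord_space (acoords G i) \<and>
        ((\<lambda>x. util G i (a(i := x)) \<theta>) has_derivative (\<lambda>h. inner h (D i a \<theta>)))
          (at (a i) within acts G i))"

definition assumption_A ::
    "('d::finite, 'z::finite) bayesian_game
      \<Rightarrow> (nat \<Rightarrow> (nat \<Rightarrow> real ^ 'z) \<Rightarrow> (nat \<Rightarrow> real ^ 'd) \<Rightarrow> real ^ 'z) \<Rightarrow> bool" where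
  "assumption_A G D \<longleftrightarrow>
     (\<forall>i\<in>players G.
        continuous_on (act_profiles G \<times> type_profiles G) (\<lambda>(a, \<theta>). util G i a \<theta>) \<and>
        (\<forall>\<theta>\<in>type_profiles G. continuous_on (act_profiles G) (\<lambda>a. D i a \<theta>)) \<and>
        (\<forall>a\<in>act_profiles G. (\<lambda>\<theta>. D i a \<theta>) \<in> borel_measurable (borel_on (type_profiles G))) \<and>
        (\<forall>x\<in>acts G i. \<forall>f\<in>other_strategies G i.
           \<exists>h :: real ^ 'd \<Rightarrow> (nat \<Rightarrow> real ^ 'd) \<Rightarrow> real.
             (\<forall>t\<in>typs G i. \<forall>\<theta>\<in>other_types G i. 0 \<le> h t \<theta>) \<and>
             (\<forall>t\<in>typs G i. integrable (cond G i t) (h t) \<and>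
                (\<exists>U. openin (top_of_set (acts G i)) U \<and> x \<in> U \<and>
                   (\<forall>\<theta>\<in>other_types G i. \<forall>y\<in>U.
                      norm (D i ((play_others G i f \<theta>)(i := y)) (\<theta>(i := t))) \<le> h t \<theta>)))) \<and>
        (\<forall>S\<in>sets (borel_on (other_types G i)).
           (\<lambda>t. measure (cond G i t) S) \<in> borel_measurable (borel_on (typs G i))))"

definition assumption_B ::
    "('d::finite, 'z::finite) bayesian_game
      \<Rightarrow> (nat \<Rightarrow> (nat \<Rightarrow> real ^ 'z) \<Rightarrow> (nat \<Rightarrow> real ^ 'd) \<Rightarrow> real ^ 'z)
      \<Rightarrow> (nat \<Rightarrow> real) \<Rightarrow> (nat \<Rightarrow> nat \<Rightarrow> real) \<Rightarrow> bool" where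
  "assumption_B G D \<sigma> \<tau> \<longleftrightarrow>
     (\<forall>i\<in>players G.
        \<sigma> i > 0 \<and>
        (\<forall>x\<in>acts G i. \<forall>y\<in>acts G i. \<forall>a\<in>other_acts G i. \<forall>\<theta>\<in>type_profiles G.
           inner (D i (a(i := x)) \<theta> - D i (a(i := y)) \<theta>) (x - y) \<le> - \<sigma> i * (norm (x - y))\<^sup>2) \<and>
        (\<forall>j\<in>others G i. \<tau> i j \<ge> 0) \<and>
        (\<forall>a\<in>other_acts G i. \<forall>b\<in>other_acts G i. \<forall>x\<in>acts G i. \<forall>\<theta>\<in>type_profiles G.
           norm (D i (a(i := x)) \<theta> - D i (b(i := x)) \<theta>)
             \<le> (\<Sum>j\<in>others G i. \<tau> i j * norm (a j - b j))))"

text \<open>For probability measures on the same measurable space the supremum is over a set bounded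
  by 2, so the real-valued \<open>SUP\<close> is meaningful.\<close>

definition tv_dist :: "'a measure \<Rightarrow> 'a measure \<Rightarrow> real" where
  "tv_dist \<mu> \<nu> =
     (1 / 2) * (SUP h\<in>{h :: 'a \<Rightarrow> real. h \<in> borel_measurable \<mu> \<and> (\<forall>x\<in>space \<mu>. \<bar>h x\<bar> \<le> 1)}.
        \<bar>(\<integral>x. h x \<partial>\<mu>) - (\<integral>x. h x \<partial>\<nu>)\<bar>)"

definition assumption_C ::
    "('d::finite, 'z::finite) bayesian_game
      \<Rightarrow> (nat \<Rightarrow> (nat \<Rightarrow> real ^ 'z) \<Rightarrow> (nat \<Rightarrow> real ^ 'd) \<Rightarrow> real ^ 'z) \<Rightarrow> bool" where
  "assumption_C G D \<longleftrightarrow>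
     (\<forall>i\<in>players G.
        bdd_above ((\<lambda>(a, \<theta>). norm (D i a \<theta>)) ` (act_profiles G \<times> type_profiles G)) \<and>
        (\<exists>\<nu> :: (nat \<Rightarrow> real ^ 'd) \<Rightarrow> real.
           \<nu> \<in> borel_measurable (borel_on (other_types G i)) \<and>
           (\<forall>\<theta>\<in>other_types G i. 0 \<le> \<nu> \<theta>) \<and>
           (\<forall>a\<in>act_profiles G. \<forall>s\<in>typs G i. \<forall>t\<in>typs G i. \<forall>\<theta>\<in>other_types G i.
              norm (D i a (\<theta>(i := s)) - D i a (\<theta>(i := t))) \<le> \<nu> \<theta> * norm (s - t)) \<and>
           (SUP t\<in>typs G i. \<integral>\<^sup>+ \<theta>. ennreal (\<nu> \<theta>) \<partial>cond G i t) < \<infinity>) \<and>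
        (\<exists>\<gamma>>0. \<forall>s\<in>typs G i. \<forall>t\<in>typs G i.
           tv_dist (cond G i s) (cond G i t) \<le> \<gamma> * norm (s - t)))"

definition assumption_D :: "('d::finite, 'z::finite) bayesian_game \<Rightarrow> bool" where
  "assumption_D G \<longleftrightarrow>
     (\<forall>i\<in>players G. \<forall>x\<in>acts G i. \<forall>y\<in>acts G i. sup x y \<in> acts G i \<and> inf x y \<in> acts G i)"

definition interaction_matrix ::
    "('d::finite, 'z::finite) bayesian_game \<Rightarrow> (nat \<Rightarrow> real) \<Rightarrow> (nat \<Rightarrow> nat \<Rightarrow> real) \<Rightarrow> real mat" where
  "interaction_matrix G \<sigma> \<tau> =
     mat (nplayers G) (nplayers G) (\<lambda>(i, j). if i = j then 0 else \<tau> i j / \<sigma> i)"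

end

theory Submission
  imports Defs
begin

text \<open>
The argument runs on strong concavity and never differentiates an expected utility. By the strong
monotonicity of the own-action gradient, every utility \<open>x \<mapsto> u\<^sub>i(x, a\<^sub>-\<^sub>i, \<theta>)\<close> is \<open>\<sigma>\<^sub>i\<close>-strongly concave,
and integration preserves this. Hence an expected utility \<open>\<phi>\<close> has a unique maximizer \<open>x\<close>, and
\<open>\<phi> x - \<phi> y \<ge> \<sigma>\<^sub>i/2 \<cdot> \<parallel>x - y\<parallel>\<^sup>2\<close> for every action \<open>y\<close> (\<open>strongly_concave_on_argmax_growth\<close>). If \<open>y\<close> maximizes another
expected utility \<open>\<psi>\<close>, adding the two growth inequalities gives
\<open>\<sigma>\<^sub>i \<parallel>x - y\<parallel>\<^sup>2 \<le> (\<phi> x - \<phi> y) - (\<psi> x - \<psi> y)\<close>: the distance of the maximizers is controlled by how much the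
expected gain of \<open>x\<close> over \<open>y\<close> differs between the two problems. By the mean value theorem, this gain
inherits every bound and every Lipschitz property of the gradient, with an additional
factor \<open>\<parallel>x - y\<parallel>\<close> that cancels. This is used twice.

\<^item> If only the own type changes, the Lipschitz dependence of the gradient and of the conditional law
  (in total variation) on the type yields \<open>best_response_type_lipschitz\<close>: best responses are
  Lipschitz in the type, with a constant independent of the opponents' strategies. In particular
  best responses are measurable, so that the best-response map \<open>response\<close> acts on strategy
  profiles, and all its fixed points, the equilibria, share one Lipschitz constant.
\<^item> If only the opponents' strategies change, the Lipschitz dependence of the gradient on their actions
  yields \<open>best_response_strategy_lipschitz\<close>. For two equilibria, the vector \<open>e\<close> of uniform distances
  between the players' strategies thus satisfies \<open>e \<le> M e\<close>. A nonnegative matrix of spectral radius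
  below 1 admits only \<open>e = 0\<close> (\<open>subinvariant_vector_zero\<close>), whence uniqueness.

For existence, let \<open>x\<close> be the best response to \<open>f\<close> and \<open>y\<close> the one to \<open>g \<ge> f\<close>. Since \<open>x\<close> is at least
as good as \<open>x \<sqinter> y\<close> against \<open>f\<close>, single crossing transfers this to \<open>g\<close>, and weak quasi-supermodularity
makes \<open>x \<squnion> y\<close> at least as good as \<open>y\<close> against \<open>g\<close>; uniqueness gives \<open>x \<squnion> y = y\<close>, that is \<open>x \<le> y\<close>. So \<open>response\<close> is
isotone. Its iterates from the profile of greatest actions (which exist in a compact sublattice)
decrease and converge pointwise; as the expected utility is jointly continuous along pointwise
convergent strategies, by dominated convergence, the limit is an equilibrium. Any
equilibrium lies below every iterate, hence below the limit, which is therefore the greatest one. The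
least equilibrium arises from the profile of least actions. If single crossing also holds in
the own type, the same comparison of best responses, now at two types, shows that all iterates are
increasing in the type, and so is the limit.
\<close>

section \<open>Strong concavity and the distance of maximizers\<close>

lemma gradient_mean_value:
  fixes g :: "'a::real_inner \<Rightarrow> real"
  assumes S: "convex S" "x \<in> S" "y \<in> S"
    and g: "\<And>z. z \<in> S \<Longrightarrow> (g has_derivative (\<lambda>h. inner h (g' z))) (at z within S)"
  obtains s where "0 < s" "s < 1" "x + s *\<^sub>R (y - x) \<in> S"
    "g y - g x = inner (y - x) (g' (x + s *\<^sub>R (y - x)))"
proof -
  define p where "p s = x + s *\<^sub>R (y - x)" for s
  have p_in: "p s \<in> S" if "0 \<le> s" "s \<le> 1" for s
    using convexD_alt[OF S that] by (simp add: p_def algebra_simps)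
  have "((\<lambda>s. g (p s)) has_derivative (\<lambda>h. inner (h *\<^sub>R (y - x)) (g' (p s)))) (at s within {0..1})"
    if "0 \<le> s" "s \<le> 1" for s
  proof (rule has_derivative_in_compose2[where t = S and f = p])
    show "p ` {0..1} \<subseteq> S" using p_in by auto
    show "(p has_derivative (\<lambda>h. h *\<^sub>R (y - x))) (at s within {0..1})"
      unfolding p_def by (auto intro!: derivative_eq_intros)
  qed (use that g in auto)
  then obtain s where s: "s \<in> {0<..<1}" "g (p 1) - g (p 0) = inner ((1 - 0) *\<^sub>R (y - x)) (g' (p s))"
    using mvt_simple[of 0 1 "\<lambda>s. g (p s)" "\<lambda>s h. inner (h *\<^sub>R (y - x)) (g' (p s))"] by auto
  then show thesis
    using that[of s] p_in[of s] by (simp add: p_def)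
qed

lemma bounded_gradient_imp_lipschitz:
  fixes g :: "'a::real_inner \<Rightarrow> real"
  assumes S: "convex S" "x \<in> S" "y \<in> S"
    and g: "\<And>z. z \<in> S \<Longrightarrow> (g has_derivative (\<lambda>h. inner h (g' z))) (at z within S)"
    and bound: "\<And>z. z \<in> S \<Longrightarrow> norm (g' z) \<le> C"
  shows "\<bar>g x - g y\<bar> \<le> C * norm (x - y)"
proof -
  obtain s where s: "x + s *\<^sub>R (y - x) \<in> S" "g y - g x = inner (y - x) (g' (x + s *\<^sub>R (y - x)))"
    by (rule gradient_mean_value[OF S g])
  have "\<bar>g y - g x\<bar> \<le> norm (y - x) * norm (g' (x + s *\<^sub>R (y - x)))"
    unfolding s(2) by (rule Cauchy_Schwarz_ineq2)
  also have "\<dots> \<le> norm (y - x) * C"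
    by (intro mult_left_mono bound s(1)) auto
  finally show ?thesis by (simp add: abs_minus_commute norm_minus_commute mult.commute)
qed

definition strongly_concave_on :: "real \<Rightarrow> 'a::real_normed_vector set \<Rightarrow> ('a \<Rightarrow> real) \<Rightarrow> bool" where
  "strongly_concave_on c S g \<longleftrightarrow> (\<forall>x\<in>S. \<forall>y\<in>S. \<forall>s\<in>{0..1}.
     g (x + s *\<^sub>R (y - x)) \<ge> (1 - s) * g x + s * g y + c / 2 * s * (1 - s) * (norm (x - y))\<^sup>2)"

lemma strongly_monotone_gradient_imp_strongly_concave:
  fixes g :: "'a::real_inner \<Rightarrow> real"
  assumes S: "convex S"
    and g: "\<And>z. z \<in> S \<Longrightarrow> (g has_derivative (\<lambda>h. inner h (g' z))) (at z within S)"
    and mono: "\<And>x y. x \<in> S \<Longrightarrow> y \<in> S \<Longrightarrow> inner (g' x - g' y) (x - y) \<le> - c * (norm (x - y))\<^sup>2"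
  shows "strongly_concave_on c S g"
proof -
  have first_order: "g y \<le> g x + inner (y - x) (g' x) - c / 2 * (norm (y - x))\<^sup>2"
    if xy: "x \<in> S" "y \<in> S" for x y
  proof -
    (* The tangent at x and a parabola are removed from g, so that the claim becomes k y \<le> k x;
       strong monotonicity makes the slope of k on the way from x to y nonpositive. *)
    define k where "k z = g z - inner z (g' x) + c / 2 * inner (z - x) (z - x)" for z
    have k': "(k has_derivative (\<lambda>h. inner h (g' z - g' x + c *\<^sub>R (z - x)))) (at z within S)" if "z \<in> S" for z
      unfolding k_def
      by (rule derivative_eq_intros g that refl)+
        (auto simp: inner_simps algebra_simps inner_commute)
    obtain s where s: "0 < s" "x + s *\<^sub>R (y - x) \<in> S"
      "k y - k x = inner (y - x) (g' (x + s *\<^sub>R (y - x)) - g' x + c *\<^sub>R (x + s *\<^sub>R (y - x) - x))"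
      by (rule gradient_mean_value[OF S xy k'])
    have "s * (k y - k x) = inner (g' (x + s *\<^sub>R (y - x)) - g' x) ((x + s *\<^sub>R (y - x)) - x)
      + c * (norm ((x + s *\<^sub>R (y - x)) - x))\<^sup>2"
      unfolding s(3) by (simp add: inner_simps inner_commute power2_norm_eq_inner algebra_simps)
    also have "\<dots> \<le> 0"
      using mono[OF s(2) xy(1)] by simp
    finally have "k y \<le> k x"
      using s(1) by (simp add: mult_le_0_iff)
    then show ?thesis
      by (simp add: k_def power2_norm_eq_inner inner_diff_left)
  qed
  show ?thesis
    unfolding strongly_concave_on_def
  proof (intro ballI)
    fix x y s assume xy: "x \<in> S" "y \<in> S" and s: "s \<in> {0..1::real}"
    define z where "z = x + s *\<^sub>R (y - x)"
    have z: "z \<in> S" using convexD_alt[OF S xy, of s] s by (simp add: z_def algebra_simps)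
    have eq: "x - z = s *\<^sub>R (x - y)" "y - z = (1 - s) *\<^sub>R (y - x)"
      by (simp_all add: z_def algebra_simps)
    have "(1 - s) * g x + s * g y \<le>
        (1 - s) * (g z + inner (x - z) (g' z) - c / 2 * (norm (x - z))\<^sup>2)
      + s * (g z + inner (y - z) (g' z) - c / 2 * (norm (y - z))\<^sup>2)"
      using s by (intro add_mono mult_left_mono first_order xy z) auto
    also have "\<dots> = g z - c / 2 * s * (1 - s) * (norm (x - y))\<^sup>2"
      unfolding eq norm_scaleR power_mult_distrib power2_abs norm_minus_commute[of y x]
      by (simp add: inner_simps power2_eq_square field_simps)
    finally show "(1 - s) * g x + s * g y + c / 2 * s * (1 - s) * (norm (x - y))\<^sup>2
        \<le> g (x + s *\<^sub>R (y - x))"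
      by (simp add: z_def)
  qed
qed

text \<open>The constant \<open>c / 2\<close> is sharp: two such inequalities add up to the full modulus \<open>c\<close>, so that the ratios
\<open>\<tau> / \<sigma>\<close> of the interaction matrix arise without an additional factor. Midpoint concavity would give only \<open>c / 4\<close>.\<close>

lemma strongly_concave_on_argmax_growth:
  assumes conc: "strongly_concave_on c S g" and S: "convex S"
    and x: "is_arg_max g (\<lambda>x. x \<in> S) x" and y: "y \<in> S"
  shows "g x - g y \<ge> c / 2 * (norm (x - y))\<^sup>2"
proof -
  have xS: "x \<in> S" using x by (simp add: is_arg_max_def)
  let ?q = "c / 2 * (norm (x - y))\<^sup>2"
  (* The point at fraction s from x to y is no better than x; dividing the concavity inequality by s
     leaves a bound that improves to ?q as s tends to 0. *)
  have le: "(1 - s) * ?q \<le> g x - g y" if s: "0 < s" "s < 1" for s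
  proof -
    have "x + s *\<^sub>R (y - x) \<in> S"
      using convexD_alt[OF S xS y, of s] s by (simp add: algebra_simps)
    then have "g (x + s *\<^sub>R (y - x)) \<le> g x"
      using x by (auto simp: is_arg_max_def not_less)
    moreover have "(1 - s) * g x + s * g y + c / 2 * s * (1 - s) * (norm (x - y))\<^sup>2
        \<le> g (x + s *\<^sub>R (y - x))"
      using conc xS y s by (auto simp: strongly_concave_on_def)
    ultimately have "s * ((1 - s) * ?q) \<le> s * (g x - g y)"
      by (simp add: algebra_simps)
    then show ?thesis using s by simp
  qed
  have "((\<lambda>s. (1 - s) * ?q) \<longlongrightarrow> (1 - 0) * ?q) (at_right 0)"
    by (intro tendsto_intros)
  moreover have "eventually (\<lambda>s. (1 - s) * ?q \<le> g x - g y) (at_right 0)"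
    unfolding eventually_at_right_field by (intro exI[of _ 1] conjI allI impI le) auto
  ultimately have "(1 - 0) * ?q \<le> g x - g y"
    by (rule tendsto_upperbound) simp
  then show ?thesis by simp
qed

lemma strongly_concave_on_argmax_unique:
  assumes "strongly_concave_on c S g" "convex S" "c > 0"
    and x: "is_arg_max g (\<lambda>x. x \<in> S) x" and y: "y \<in> S" "g y \<ge> g x"
  shows "y = x"
proof -
  have "c / 2 * (norm (x - y))\<^sup>2 \<le> 0"
    using strongly_concave_on_argmax_growth[OF assms(1,2) x y(1)] y(2) by linarith
  then show ?thesis using \<open>c > 0\<close> by (simp add: mult_le_0_iff)
qed

text \<open>The growth inequality at \<open>x\<close> for \<open>g\<close> and at \<open>y\<close> for \<open>k\<close> add up to
\<open>c \<parallel>x - y\<parallel>\<^sup>2 \<le> (g x - g y) - (k x - k y)\<close>; one factor \<open>\<parallel>x - y\<parallel>\<close> then cancels.\<close>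

lemma strongly_concave_on_argmax_dist:
  assumes "strongly_concave_on c S g" "strongly_concave_on c S k" "convex S"
    and x: "is_arg_max g (\<lambda>x. x \<in> S) x" and y: "is_arg_max k (\<lambda>x. x \<in> S) y"
    and diff: "(g x - g y) - (k x - k y) \<le> C * norm (x - y)" and "0 \<le> C"
  shows "c * norm (x - y) \<le> C"
proof (cases "x = y")
  case False
  have xy: "x \<in> S" "y \<in> S" using x y by (auto simp: is_arg_max_def)
  have "c * norm (x - y) * norm (x - y) \<le> C * norm (x - y)"
    using strongly_concave_on_argmax_growth[OF assms(1,3) x xy(2)]
      strongly_concave_on_argmax_growth[OF assms(2,3) y xy(1)] diff
    by (simp add: norm_minus_commute[of y x] power2_eq_square)
  then show ?thesis using False by simp
qed (use \<open>0 \<le> C\<close> in simp)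

section \<open>Order: extremal points, comparison of maximizers, monotone limits\<close>

lemma compact_sup_closed_has_greatest:
  fixes S :: "(real ^ 'k::finite) set"
  assumes S: "compact S" "S \<noteq> {}" and sup: "\<And>x y. x \<in> S \<Longrightarrow> y \<in> S \<Longrightarrow> sup x y \<in> S"
  obtains m where "m \<in> S" "\<And>x. x \<in> S \<Longrightarrow> x \<le> m"
proof -
  (* Each coordinate is maximal at some point of S, and the join of these finitely many points is
     maximal in all coordinates; the joins are taken one coordinate at a time. *)
  have "\<exists>m\<in>S. \<forall>k\<in>K. \<forall>x\<in>S. vec_nth x k \<le> vec_nth m k" for K :: "'k set"
    using finite[of K]
  proof (induction K)
    case empty
    then show ?case using S by auto
  next
    case (insert k K)
    then obtain m where m: "m \<in> S" "\<forall>k\<in>K. \<forall>x\<in>S. vec_nth x k \<le> vec_nth m k" by auto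
    have "continuous_on S (\<lambda>x. vec_nth x k)" by (intro continuous_intros)
    then obtain p where p: "p \<in> S" "\<forall>x\<in>S. vec_nth x k \<le> vec_nth p k"
      using continuous_attains_sup[OF S] by blast
    have "sup m p \<in> S" using sup m p by auto
    moreover have "vec_nth x l \<le> vec_nth (sup m p) l" if "l \<in> insert k K" "x \<in> S" for l x
    proof -
      have "vec_nth x l \<le> vec_nth m l \<or> vec_nth x l \<le> vec_nth p l" using that m(2) p(2) by blast
      then show ?thesis by (auto simp: sup_vec_def sup_real_def)
    qed
    ultimately show ?case by blast
  qed
  then obtain m where "m \<in> S" "\<forall>k\<in>UNIV. \<forall>x\<in>S. vec_nth x k \<le> vec_nth m k" by blast
  then show thesis by (intro that[of m]) (auto simp: Finite_Cartesian_Product.less_eq_vec_def)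
qed

lemma compact_inf_closed_has_least:
  fixes S :: "(real ^ 'k::finite) set"
  assumes S: "compact S" "S \<noteq> {}" and inf: "\<And>x y. x \<in> S \<Longrightarrow> y \<in> S \<Longrightarrow> inf x y \<in> S"
  obtains m where "m \<in> S" "\<And>x. x \<in> S \<Longrightarrow> m \<le> x"
proof -
  have sup_neg: "sup (- x) (- y) = - inf x y" for x y :: "real ^ 'k"
    by (simp add: Finite_Cartesian_Product.vec_eq_iff sup_vec_def inf_vec_def sup_real_def inf_real_def max_def min_def)
  obtain m where "m \<in> uminus ` S" "\<And>x. x \<in> uminus ` S \<Longrightarrow> x \<le> m"
  proof (rule compact_sup_closed_has_greatest[of "uminus ` S"])
    show "compact (uminus ` S)" using S by (simp add: compact_negations)
    show "sup x y \<in> uminus ` S" if "x \<in> uminus ` S" "y \<in> uminus ` S" for x y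
      using that inf by (auto simp: sup_neg)
  qed (use S in auto)
  then show thesis using that by (fastforce simp: Finite_Cartesian_Product.less_eq_vec_def)
qed

text \<open>The crossing condition carries \<open>g (inf x y) \<le> g x\<close> over to \<open>k\<close>; quasi-supermodularity turns this
into \<open>k y \<le> k (sup x y)\<close>, and uniqueness of the maximizer of \<open>k\<close> forces \<open>sup x y = y\<close>.\<close>

lemma argmax_mono:
  fixes S :: "'a::lattice set" and g k :: "'a \<Rightarrow> real"
  assumes S: "\<And>x y. x \<in> S \<Longrightarrow> y \<in> S \<Longrightarrow> sup x y \<in> S \<and> inf x y \<in> S"
    and k: "weakly_quasi_supermodular S k"
    and crossing: "\<And>x x'. x \<in> S \<Longrightarrow> x' \<in> S \<Longrightarrow> x \<le> x' \<Longrightarrow> g x \<le> g x' \<Longrightarrow> k x \<le> k x'"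
    and x: "is_arg_max g (\<lambda>x. x \<in> S) x" and y: "y \<in> S"
    and unique: "\<And>z. z \<in> S \<Longrightarrow> k y \<le> k z \<Longrightarrow> z = y"
  shows "x \<le> y"
proof -
  have xS: "x \<in> S" using x by (simp add: is_arg_max_def)
  have "g (inf x y) \<le> g x" using x S[OF xS y] unfolding is_arg_max_linorder by blast
  then have "k (inf x y) \<le> k x" using S[OF xS y] xS by (intro crossing) auto
  then have "k y \<le> k (sup x y)" using k xS y by (auto simp: weakly_quasi_supermodular_def)
  then have "sup x y = y" using unique S[OF xS y] by blast
  then show ?thesis by (simp add: le_iff_sup)
qed

lemma bounded_monotone_vec_convergent:
  fixes X :: "nat \<Rightarrow> real ^ 'k::finite"
  assumes bounded: "bounded (range X)"
    and mono: "(\<forall>k. X k \<le> X (Suc k)) \<or> (\<forall>k. X (Suc k) \<le> X k)"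
  shows "convergent X"
proof -
  have "convergent (\<lambda>k. vec_nth (X k) j)" for j
  proof (rule Bseq_monoseq_convergent)
    obtain B where "\<And>k. norm (X k) \<le> B" using bounded by (auto simp: bounded_iff)
    then show "Bseq (\<lambda>k. vec_nth (X k) j)"
      by (intro BseqI'[of _ B]) (metis component_le_norm_cart order_trans real_norm_def)
    show "monoseq (\<lambda>k. vec_nth (X k) j)"
      using mono by (auto simp: monoseq_Suc Finite_Cartesian_Product.less_eq_vec_def)
  qed
  then obtain l where "\<And>j. (\<lambda>k. vec_nth (X k) j) \<longlonglongrightarrow> l j" unfolding convergent_def by metis
  then have "X \<longlonglongrightarrow> (\<chi> j. l j)" by (intro vec_tendstoI) simp
  then show ?thesis by (auto simp: convergent_def)
qed

lemma LIMSEQ_le_vec: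
  fixes X Y :: "nat \<Rightarrow> real ^ 'k::finite"
  assumes "X \<longlonglongrightarrow> x" "Y \<longlonglongrightarrow> y" "\<And>k. X k \<le> Y k"
  shows "x \<le> y"
  unfolding Finite_Cartesian_Product.less_eq_vec_def
proof
  fix j
  show "vec_nth x j \<le> vec_nth y j"
    using assms(3) by (intro LIMSEQ_le[OF tendsto_vec_nth[OF assms(1)] tendsto_vec_nth[OF assms(2)]])
      (auto simp: Finite_Cartesian_Product.less_eq_vec_def)
qed

section \<open>Products of spaces and total variation\<close>

lemma compact_PiE:
  fixes X :: "'i \<Rightarrow> 'a::topological_space set"
  assumes "\<And>i. i \<in> I \<Longrightarrow> compact (X i)"
  shows "compact (PiE I X)"
proof -
  (* Off I an extensional function has the single value undefined, so the product over I is a product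
     over all indices with singleton factors added; Tychonoff applies to the latter. *)
  have "compact (PiE UNIV (\<lambda>i. if i \<in> I then X i else {undefined}))"
    using assms compactin_PiE[of "\<lambda>_. euclidean" UNIV "\<lambda>i. if i \<in> I then X i else {undefined}"]
    by (auto simp: euclidean_product_topology)
  moreover have "PiE UNIV (\<lambda>i. if i \<in> I then X i else {undefined}) = PiE I X"
    by (auto simp: PiE_iff extensional_def split: if_splits)
  ultimately show ?thesis by simp
qed

lemma tendsto_fun_coordinatewise:
  fixes X :: "'b \<Rightarrow> 'i \<Rightarrow> 'a::topological_space"
  assumes "\<And>i. ((\<lambda>k. X k i) \<longlongrightarrow> l i) F"
  shows "(X \<longlongrightarrow> l) F"
  using limitin_componentwise[of "\<lambda>_. euclidean" UNIV X l F] assms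
  by (simp add: euclidean_product_topology)

text \<open>The normalized function \<open>h / c\<close> is a competitor in the supremum that defines the distance.\<close>

lemma tv_dist_integral_diff_le:
  fixes h :: "'a \<Rightarrow> real"
  assumes "prob_space \<mu>" "prob_space \<nu>" and sets: "sets \<nu> = sets \<mu>"
    and h: "h \<in> borel_measurable \<mu>" "\<And>x. x \<in> space \<mu> \<Longrightarrow> \<bar>h x\<bar> \<le> c" and c: "0 < c"
  shows "\<bar>(\<integral>x. h x \<partial>\<mu>) - (\<integral>x. h x \<partial>\<nu>)\<bar> \<le> 2 * c * tv_dist \<mu> \<nu>"
proof -
  interpret mu: prob_space \<mu> by fact
  interpret nu: prob_space \<nu> by fact
  have sp: "space \<nu> = space \<mu>" using sets by (rule sets_eq_imp_space_eq)
  define H where "H = {h :: 'a \<Rightarrow> real. h \<in> borel_measurable \<mu> \<and> (\<forall>x\<in>space \<mu>. \<bar>h x\<bar> \<le> 1)}"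
  (* The supremum in tv_dist dominates its members only because it is over a bounded set. *)
  have bound: "\<bar>(\<integral>x. k x \<partial>\<mu>) - (\<integral>x. k x \<partial>\<nu>)\<bar> \<le> 2" if k: "k \<in> H" for k
  proof -
    have m: "k \<in> borel_measurable \<mu>" "\<And>x. x \<in> space \<mu> \<Longrightarrow> \<bar>k x\<bar> \<le> 1" using k by (auto simp: H_def)
    have m': "k \<in> borel_measurable \<nu>" using m(1) sets by (simp cong: measurable_cong_sets)
    have i1: "integrable \<mu> k" by (rule mu.integrable_const_bound[of _ 1]) (use m in auto)
    have i2: "integrable \<nu> k" by (rule nu.integrable_const_bound[of _ 1]) (use m m' sp in auto)
    have "\<bar>\<integral>x. k x \<partial>\<mu>\<bar> \<le> (\<integral>x. \<bar>k x\<bar> \<partial>\<mu>)" "\<bar>\<integral>x. k x \<partial>\<nu>\<bar> \<le> (\<integral>x. \<bar>k x\<bar> \<partial>\<nu>)"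
      by (rule integral_abs_bound)+
    moreover have "(\<integral>x. \<bar>k x\<bar> \<partial>\<mu>) \<le> 1"
      by (rule mu.integral_le_const) (use i1 m in auto)
    moreover have "(\<integral>x. \<bar>k x\<bar> \<partial>\<nu>) \<le> 1"
      by (rule nu.integral_le_const) (use i2 m sp in auto)
    ultimately show ?thesis by linarith
  qed
  have "(\<lambda>x. h x / c) \<in> H" using h c by (auto simp: H_def)
  then have "\<bar>(\<integral>x. h x / c \<partial>\<mu>) - (\<integral>x. h x / c \<partial>\<nu>)\<bar>
      \<le> (SUP k\<in>H. \<bar>(\<integral>x. k x \<partial>\<mu>) - (\<integral>x. k x \<partial>\<nu>)\<bar>)"
    by (intro cSUP_upper2[of _ _ "\<lambda>x. h x / c"] bdd_aboveI2[of _ _ 2] bound) auto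
  also have "\<dots> = 2 * tv_dist \<mu> \<nu>" by (simp add: tv_dist_def H_def)
  finally have "\<bar>(\<integral>x. h x \<partial>\<mu>) - (\<integral>x. h x \<partial>\<nu>)\<bar> / c \<le> 2 * tv_dist \<mu> \<nu>"
    using c by (simp add: abs_divide flip: diff_divide_distrib)
  then show ?thesis using c by (simp add: field_simps)
qed

section \<open>Nonnegative matrices of spectral radius below one\<close>

text \<open>Iterating \<open>e \<le> m e\<close> gives \<open>e \<le> m\<^sup>k e\<close>, and the powers of \<open>m\<close> tend to zero.\<close>

lemma subinvariant_vector_zero:
  fixes m :: "nat \<Rightarrow> nat \<Rightarrow> real" and e :: "nat \<Rightarrow> real"
  assumes n: "0 < n"
    and m: "\<And>i j. i < n \<Longrightarrow> j < n \<Longrightarrow> 0 \<le> m i j" and e: "\<And>i. i < n \<Longrightarrow> 0 \<le> e i"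
    and sub: "\<And>i. i < n \<Longrightarrow> e i \<le> (\<Sum>j<n. m i j * e j)"
    and rho: "spectral_radius (mat n n (\<lambda>(i, j). complex_of_real (m i j))) < 1"
    and i: "i < n"
  shows "e i = 0"
proof -
  define A where "A = mat n n (\<lambda>(i, j). complex_of_real (m i j))"
  have A: "A \<in> carrier_mat n n" by (simp add: A_def)
  have rhoA: "spectral_radius A < 1" using rho by (simp add: A_def)
  have "0 \<le> spectral_radius A"
    using spectral_radius_mem_max(1)[OF A n] by auto
  (* Bounded powers of A alone would not force e to vanish. Dividing by some r strictly between the
     spectral radius and 1 leaves B with bounded powers, and the powers of A = r B decay like r ^ k. *)
  obtain r where r: "spectral_radius A < r" "r < 1" using dense[OF rhoA] by auto
  have r0: "0 < r" using r \<open>0 \<le> spectral_radius A\<close> by linarith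
  define B where "B = mat n n (\<lambda>(i, j). complex_of_real (m i j / r))"
  have B: "B \<in> carrier_mat n n" by (simp add: B_def)
  have AB: "A = complex_of_real r \<cdot>\<^sub>m B"
    using r0 by (intro eq_matI) (auto simp: A_def B_def)
  have "spectral_radius B < 1"
  proof -
    obtain k where k: "spectral_radius B = norm k" "eigenvalue B k"
      using spectral_radius_mem_max(1)[OF B n] by (auto simp: spectrum_def)
    then obtain v where v: "v \<in> carrier_vec n" "v \<noteq> 0\<^sub>v n" "B *\<^sub>v v = k \<cdot>\<^sub>v v"
      using B by (auto simp: eigenvalue_def eigenvector_def)
    have "A *\<^sub>v v = complex_of_real r \<cdot>\<^sub>v (B *\<^sub>v v)"
      unfolding AB using B v(1)
      by (intro eq_vecI) (auto simp: scalar_prod_def sum_distrib_left mult.assoc)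
    also have "\<dots> = (complex_of_real r * k) \<cdot>\<^sub>v v"
      unfolding v(3) by (rule smult_smult_assoc)
    finally have "eigenvalue A (complex_of_real r * k)"
      using v(1,2) A unfolding eigenvalue_def eigenvector_def by (intro exI[of _ v]) auto
    then have "norm (complex_of_real r * k) \<le> spectral_radius A"
      by (intro spectral_radius_mem_max(2)[OF A n] imageI) (simp add: spectrum_def)
    then have "r * norm k \<le> spectral_radius A" using r0 by (simp add: norm_mult)
    then have "r * norm k < r * 1" using r by linarith
    then show ?thesis using r0 k by (simp only: mult_less_cancel_left_pos)
  qed
  then obtain c where c: "\<And>k. norm_bound (B ^\<^sub>m k) c"
    using spectral_radius_jnf_norm_bound_less_1_upper_triangular[OF B] by blast
  have Bk: "B ^\<^sub>m k \<in> carrier_mat n n" for k using B by simp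
  define w where "w x = vec n (\<lambda>i. complex_of_real (x i))" for x :: "nat \<Rightarrow> real"
  (* Subinvariance in terms of B reads e / r \<le> B e. The claim is stated for arbitrary real vectors x
     above t e, because the induction replaces x by B x. *)
  have grow: "\<exists>y. B ^\<^sub>m k *\<^sub>v w x = w y \<and> (\<forall>i<n. t / r ^ k * e i \<le> y i)"
    if "0 \<le> t" "\<forall>i<n. t * e i \<le> x i" for k t x
    using that
  proof (induction k arbitrary: t x)
    case 0
    then show ?case using B by (intro exI[of _ x]) (auto simp: w_def)
  next
    case (Suc k)
    define y where "y i = (\<Sum>j<n. m i j / r * x j)" for i
    have Bw: "B *\<^sub>v w x = w y"
      by (intro eq_vecI)
        (auto simp: B_def w_def y_def scalar_prod_def lessThan_atLeast0)
    have "t / r * e i \<le> y i" if "i < n" for i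
    proof -
      have "t / r * e i \<le> t / r * (\<Sum>j<n. m i j * e j)"
        using Suc.prems(1) r0 by (intro mult_left_mono sub that) auto
      also have "\<dots> = (\<Sum>j<n. m i j / r * (t * e j))"
        by (simp add: sum_distrib_left field_simps)
      also have "\<dots> \<le> y i"
        unfolding y_def using r0 that Suc.prems(2) by (intro sum_mono mult_left_mono) (auto simp: m)
      finally show ?thesis .
    qed
    then obtain z where z: "B ^\<^sub>m k *\<^sub>v w y = w z" "\<forall>i<n. t / r / r ^ k * e i \<le> z i"
      using Suc.IH[of "t / r" y] Suc.prems(1) r0 by auto
    have "B ^\<^sub>m Suc k *\<^sub>v w x = B ^\<^sub>m k *\<^sub>v (B *\<^sub>v w x)"
      using assoc_mult_mat_vec[OF Bk B] by (simp add: w_def)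
    then show ?case using z by (auto simp: Bw)
  qed
  define C where "C = (\<Sum>j<n. c * e j)"
  have "e i \<le> C * r ^ k" for k
  proof -
    obtain y where y: "B ^\<^sub>m k *\<^sub>v w e = w y" "1 / r ^ k * e i \<le> y i"
      using grow[of 1 e k] i by auto
    have "complex_of_real (y i) = (B ^\<^sub>m k *\<^sub>v w e) $ i"
      unfolding y(1) using i by (simp add: w_def)
    also have "\<dots> = (\<Sum>j<n. (B ^\<^sub>m k) $$ (i, j) * complex_of_real (e j))"
      using i carrier_matD[OF Bk[of k]] by (simp add: w_def scalar_prod_def lessThan_atLeast0)
    finally have "norm (complex_of_real (y i)) \<le> (\<Sum>j<n. norm ((B ^\<^sub>m k) $$ (i, j) * complex_of_real (e j)))"
      by (simp only: norm_sum)
    also have "\<dots> \<le> C"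
      unfolding C_def
    proof (rule sum_mono)
      fix j assume "j \<in> {..<n}"
      then have j: "j < n" by simp
      have "norm ((B ^\<^sub>m k) $$ (i, j)) \<le> c"
        by (rule c[of k, unfolded norm_bound_def, rule_format])
          (use i j carrier_matD[OF Bk[of k]] in \<open>simp_all only:\<close>)
      then show "norm ((B ^\<^sub>m k) $$ (i, j) * complex_of_real (e j)) \<le> c * e j"
        using e[OF j] by (simp add: norm_mult mult_right_mono)
    qed
    finally have "y i \<le> C" by simp
    then have "y i * r ^ k \<le> C * r ^ k" using r0 by (intro mult_right_mono) auto
    moreover have "e i \<le> y i * r ^ k" using y(2) r0 by (simp add: field_simps)
    ultimately show ?thesis by linarith
  qed
  moreover have "(\<lambda>k. C * r ^ k) \<longlonglongrightarrow> C * 0"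
    using r r0 by (intro tendsto_intros LIMSEQ_realpow_zero) auto
  ultimately have "e i \<le> C * 0"
    by (metis LIMSEQ_le_const)
  then show ?thesis using e[OF i] by simp
qed

section \<open>Expected utilities\<close>

locale smooth_bayesian_game =
  fixes G :: "('d::finite, 'z::finite) bayesian_game"
    and D :: "nat \<Rightarrow> (nat \<Rightarrow> real ^ 'z) \<Rightarrow> (nat \<Rightarrow> real ^ 'd) \<Rightarrow> real ^ 'z"
    and \<sigma> :: "nat \<Rightarrow> real" and \<tau> :: "nat \<Rightarrow> nat \<Rightarrow> real"
  assumes game: "is_bayesian_game G"
    and gradient: "own_gradient G D"
    and asm_A: "assumption_A G D"
    and asm_B: "assumption_B G D \<sigma> \<tau>"
    and asm_C: "assumption_C G D"
begin

lemma player_type_and_action_sets: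
  assumes "i \<in> players G"
  shows "typs G i \<noteq> {}" "compact (typs G i)" "acts G i \<noteq> {}" "compact (acts G i)" "convex (acts G i)"
  using game assms by (auto simp: is_bayesian_game_def)

lemma others_player: "j \<in> others G i \<Longrightarrow> j \<in> players G"
  by (simp add: others_def)

lemma cond_prob_space:
  assumes "i \<in> players G" "t \<in> typs G i"
  shows "prob_space (cond G i t)" "sets (cond G i t) = sets (borel_on (other_types G i))"
    "space (cond G i t) = other_types G i"
proof -
  show "prob_space (cond G i t)" and s: "sets (cond G i t) = sets (borel_on (other_types G i))"
    using game assms by (auto simp: is_bayesian_game_def)
  show "space (cond G i t) = other_types G i"
    using sets_eq_imp_space_eq[OF s] by (simp add: space_restrict_space)
qed

lemma measurable_cond:
  assumes "i \<in> players G" "t \<in> typs G i"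
  shows "h \<in> borel_measurable (cond G i t) \<longleftrightarrow> h \<in> borel_measurable (borel_on (other_types G i))"
  by (rule arg_cong[of _ _ "\<lambda>A. h \<in> A"], rule measurable_cong_sets[OF cond_prob_space(2)[OF assms] refl])

lemma sigma_pos: "i \<in> players G \<Longrightarrow> 0 < \<sigma> i"
  using asm_B by (simp add: assumption_B_def)

lemma act_profile_upd:
  assumes "i \<in> players G" "a \<in> other_acts G i" "x \<in> acts G i"
  shows "a(i := x) \<in> act_profiles G"
  using assms by (auto simp: act_profiles_def other_acts_def others_def PiE_iff extensional_def)

lemma type_profile_upd:
  assumes "i \<in> players G" "\<theta> \<in> other_types G i" "t \<in> typs G i"
  shows "\<theta>(i := t) \<in> type_profiles G"
  using assms by (auto simp: type_profiles_def other_types_def others_def PiE_iff extensional_def)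

lemma strategies_maps: "g \<in> strategies G j \<Longrightarrow> t \<in> typs G j \<Longrightarrow> g t \<in> acts G j"
  using measurable_space[of g "borel_on (typs G j)" "borel_on (acts G j)" t]
  by (auto simp: strategies_def space_restrict_space)

lemma play_others_in:
  assumes "f \<in> other_strategies G i" "\<theta> \<in> other_types G i"
  shows "play_others G i f \<theta> \<in> other_acts G i"
  using assms by (auto simp: play_others_def other_acts_def other_strategies_def other_types_def
      PiE_iff intro: strategies_maps)

lemma act_profiles_compact: "compact (act_profiles G)"
  unfolding act_profiles_def by (intro compact_PiE player_type_and_action_sets)

lemma type_profiles_compact: "compact (type_profiles G)"
  unfolding type_profiles_def by (intro compact_PiE player_type_and_action_sets)

lemma util_continuous:
  "i \<in> players G \<Longrightarrow> continuous_on (act_profiles G \<times> type_profiles G) (\<lambda>(a, \<theta>). util G i a \<theta>)"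
  using asm_A by (simp add: assumption_A_def)

lemma util_bounded:
  assumes "i \<in> players G"
  obtains B where "\<And>a \<theta>. a \<in> act_profiles G \<Longrightarrow> \<theta> \<in> type_profiles G \<Longrightarrow> \<bar>util G i a \<theta>\<bar> \<le> B"
proof -
  have "compact ((\<lambda>(a, \<theta>). util G i a \<theta>) ` (act_profiles G \<times> type_profiles G))"
    by (intro compact_continuous_image util_continuous assms compact_Times
        act_profiles_compact type_profiles_compact)
  then obtain B where "\<forall>u\<in>(\<lambda>(a, \<theta>). util G i a \<theta>) ` (act_profiles G \<times> type_profiles G). norm u \<le> B"
    by (meson compact_imp_bounded bounded_iff)
  then show thesis by (intro that[of B]) auto
qed

definition payoff where
  "payoff i x f t \<theta> = util G i ((play_others G i f \<theta>)(i := x)) (\<theta>(i := t))"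

lemma exp_util_eq_payoff: "exp_util G i x f t = (\<integral>\<theta>. payoff i x f t \<theta> \<partial>cond G i t)"
  by (simp add: exp_util_def payoff_def)

lemma payoff_measurable:
  assumes i: "i \<in> players G" and x: "x \<in> acts G i" and f: "f \<in> other_strategies G i" and t: "t \<in> typs G i"
  shows "payoff i x f t \<in> borel_measurable (borel_on (other_types G i))"
proof -
  let ?M = "borel_on (other_types G i)"
  have coord: "(\<lambda>\<theta>. \<theta> j) \<in> borel_measurable ?M" for j
    by (intro measurable_restrict_space1 borel_measurable_continuous_onI continuous_on_product_coordinates)
  have act: "(\<lambda>\<theta>. f j (\<theta> j)) \<in> borel_measurable ?M" if j: "j \<in> others G i" for j
  proof -
    have "(\<lambda>\<theta>. \<theta> j) \<in> measurable ?M (borel_on (typs G j))"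
      using coord j by (auto simp: measurable_restrict_space2_iff space_restrict_space other_types_def)
    moreover have "f j \<in> borel_measurable (borel_on (typs G j))"
      using f j by (auto simp: other_strategies_def strategies_def measurable_restrict_space2_iff)
    ultimately show ?thesis by (rule measurable_compose)
  qed
  have "(\<lambda>\<theta>. (play_others G i f \<theta>)(i := x)) \<in> borel_measurable ?M"
  proof (rule measurable_coordinatewise_then_product)
    fix j show "(\<lambda>\<theta>. ((play_others G i f \<theta>)(i := x)) j) \<in> borel_measurable ?M"
      using act[of j] by (cases "j = i"; cases "j \<in> others G i") (auto simp: play_others_def)
  qed
  moreover have "(\<lambda>\<theta>. \<theta>(i := t)) \<in> borel_measurable ?M"
  proof (rule measurable_coordinatewise_then_product)
    fix j show "(\<lambda>\<theta>. (\<theta>(i := t)) j) \<in> borel_measurable ?M"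
      using coord[of j] by (cases "j = i") auto
  qed
  ultimately have "(\<lambda>\<theta>. ((play_others G i f \<theta>)(i := x), \<theta>(i := t))) \<in> borel_measurable ?M"
    by (rule borel_measurable_Pair)
  then have "(\<lambda>\<theta>. ((play_others G i f \<theta>)(i := x), \<theta>(i := t)))
      \<in> measurable ?M (borel_on (act_profiles G \<times> type_profiles G))"
    using i x t by (auto simp: measurable_restrict_space2_iff space_restrict_space
        intro!: act_profile_upd type_profile_upd play_others_in f)
  from measurable_compose[OF this borel_measurable_continuous_on_restrict[OF util_continuous[OF i]]]
  show ?thesis by (simp add: payoff_def[abs_def])
qed

text \<open>The type \<open>s\<close> on which the law is conditioned may differ from the type \<open>t\<close> in the utility: the
comparison of best responses at two types needs such mixed integrals.\<close>

lemma payoff_integrable: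
  assumes i: "i \<in> players G" and x: "x \<in> acts G i" and f: "f \<in> other_strategies G i"
    and t: "t \<in> typs G i" and s: "s \<in> typs G i"
  shows "integrable (cond G i s) (payoff i x f t)"
proof -
  obtain B where "\<And>a \<theta>. a \<in> act_profiles G \<Longrightarrow> \<theta> \<in> type_profiles G \<Longrightarrow> \<bar>util G i a \<theta>\<bar> \<le> B"
    using util_bounded[OF i] by blast
  then have "\<bar>payoff i x f t \<theta>\<bar> \<le> B" if "\<theta> \<in> other_types G i" for \<theta>
    using that i x f t by (simp add: payoff_def act_profile_upd type_profile_upd play_others_in)
  moreover interpret prob_space "cond G i s" using cond_prob_space i s by blast
  show ?thesis
    by (rule integrable_const_bound[of _ B])
      (use calculation payoff_measurable[OF i x f t] i s in \<open>auto simp: measurable_cond cond_prob_space\<close>)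
qed

text \<open>Continuity of the utility gives convergence of the integrands, their common bound on the compact set
of profiles gives dominated convergence. With \<open>f\<close> constant this is continuity in the own action.\<close>

lemma exp_util_tendsto:
  assumes i: "i \<in> players G" and t: "t \<in> typs G i"
    and x: "\<And>k. x k \<in> acts G i" "y \<in> acts G i" "x \<longlonglongrightarrow> y"
    and f: "\<And>k. f k \<in> other_strategies G i" "g \<in> other_strategies G i"
      "\<And>j s. j \<in> others G i \<Longrightarrow> s \<in> typs G j \<Longrightarrow> (\<lambda>k. f k j s) \<longlonglongrightarrow> g j s"
  shows "(\<lambda>k. exp_util G i (x k) (f k) t) \<longlonglongrightarrow> exp_util G i y g t"
proof -
  obtain B where B: "\<And>a \<theta>. a \<in> act_profiles G \<Longrightarrow> \<theta> \<in> type_profiles G \<Longrightarrow> \<bar>util G i a \<theta>\<bar> \<le> B"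
    using util_bounded[OF i] by blast
  interpret prob_space "cond G i t" using cond_prob_space i t by blast
  note [simp] = cond_prob_space(3)[OF i t]
  show ?thesis
    unfolding exp_util_eq_payoff
  proof (rule integral_dominated_convergence[where w = "\<lambda>_. B"])
    show "payoff i y g t \<in> borel_measurable (cond G i t)"
      "payoff i (x k) (f k) t \<in> borel_measurable (cond G i t)" for k
      using payoff_measurable[OF i _ _ t] x f by (auto simp: measurable_cond[OF i t])
    show "AE \<theta> in cond G i t. norm (payoff i (x k) (f k) t \<theta>) \<le> B" for k
      using i t x f by (auto simp: payoff_def intro!: B act_profile_upd type_profile_upd play_others_in)
    have "(\<lambda>k. payoff i (x k) (f k) t \<theta>) \<longlonglongrightarrow> payoff i y g t \<theta>" if \<theta>: "\<theta> \<in> other_types G i" for \<theta>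
    proof -
      have "(\<lambda>k. (play_others G i (f k) \<theta>)(i := x k)) \<longlonglongrightarrow> (play_others G i g \<theta>)(i := y)"
      proof (rule tendsto_fun_coordinatewise)
        fix j show "(\<lambda>k. ((play_others G i (f k) \<theta>)(i := x k)) j) \<longlonglongrightarrow> ((play_others G i g \<theta>)(i := y)) j"
          using x(3) f(3)[of j] \<theta>
          by (cases "j = i"; cases "j \<in> others G i") (auto simp: play_others_def other_types_def)
      qed
      then have "(\<lambda>k. ((play_others G i (f k) \<theta>)(i := x k), \<theta>(i := t)))
          \<longlonglongrightarrow> ((play_others G i g \<theta>)(i := y), \<theta>(i := t))"
        by (intro tendsto_Pair tendsto_const)
      from continuous_on_tendsto_compose[OF util_continuous[OF i] this]
      show ?thesis
        using i t x f \<theta> by (simp add: payoff_def act_profile_upd type_profile_upd play_others_in)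
    qed
    then show "AE \<theta> in cond G i t. (\<lambda>k. payoff i (x k) (f k) t \<theta>) \<longlonglongrightarrow> payoff i y g t \<theta>"
      by (intro AE_I2) simp
  qed simp
qed

lemma util_has_gradient:
  assumes "i \<in> players G" "a \<in> other_acts G i" "\<theta> \<in> type_profiles G" "x \<in> acts G i"
  shows "((\<lambda>y. util G i (a(i := y)) \<theta>) has_derivative (\<lambda>h. inner h (D i (a(i := x)) \<theta>)))
    (at x within acts G i)"
proof -
  have "((\<lambda>y. util G i ((a(i := x))(i := y)) \<theta>) has_derivative (\<lambda>h. inner h (D i (a(i := x)) \<theta>)))
    (at ((a(i := x)) i) within acts G i)"
    using gradient assms act_profile_upd unfolding own_gradient_def by blast
  then show ?thesis by simp
qed

lemma util_strongly_concave:
  assumes "i \<in> players G" "a \<in> other_acts G i" "\<theta> \<in> type_profiles G"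
  shows "strongly_concave_on (\<sigma> i) (acts G i) (\<lambda>x. util G i (a(i := x)) \<theta>)"
  using assms asm_B
  by (intro strongly_monotone_gradient_imp_strongly_concave[where g' = "\<lambda>x. D i (a(i := x)) \<theta>"]
      player_type_and_action_sets util_has_gradient) (auto simp: assumption_B_def)

lemma exp_util_strongly_concave:
  assumes i: "i \<in> players G" and f: "f \<in> other_strategies G i" and t: "t \<in> typs G i"
  shows "strongly_concave_on (\<sigma> i) (acts G i) (\<lambda>x. exp_util G i x f t)"
  unfolding strongly_concave_on_def
proof (intro ballI)
  fix x y s assume x: "x \<in> acts G i" and y: "y \<in> acts G i" and s: "s \<in> {0..1::real}"
  define z where "z = x + s *\<^sub>R (y - x)"
  have z: "z \<in> acts G i"
    using convexD_alt[OF player_type_and_action_sets(5)[OF i] x y, of s] s by (simp add: z_def algebra_simps)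
  let ?q = "\<sigma> i / 2 * s * (1 - s) * (norm (x - y))\<^sup>2"
  interpret prob_space "cond G i t" using cond_prob_space i t by blast
  note int = payoff_integrable[OF i _ f t t]
  have "(1 - s) * exp_util G i x f t + s * exp_util G i y f t + ?q
      = (\<integral>\<theta>. (1 - s) * payoff i x f t \<theta> + s * payoff i y f t \<theta> + ?q \<partial>cond G i t)"
    unfolding exp_util_eq_payoff using int[OF x] int[OF y] by (simp add: prob_space)
  also have "\<dots> \<le> (\<integral>\<theta>. payoff i z f t \<theta> \<partial>cond G i t)"
  proof (rule integral_mono)
    fix \<theta> assume "\<theta> \<in> space (cond G i t)"
    then have "\<theta> \<in> other_types G i" using cond_prob_space(3)[OF i t] by simp
    then show "(1 - s) * payoff i x f t \<theta> + s * payoff i y f t \<theta> + ?q \<le> payoff i z f t \<theta>"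
      using util_strongly_concave[OF i play_others_in[OF f] type_profile_upd[OF i _ t]] x y s
      by (auto simp: strongly_concave_on_def payoff_def z_def)
  qed (use int x y z in auto)
  finally show "(1 - s) * exp_util G i x f t + s * exp_util G i y f t + ?q
      \<le> exp_util G i (x + s *\<^sub>R (y - x)) f t"
    by (simp add: exp_util_eq_payoff z_def)
qed

section \<open>Best responses and their stability\<close>

definition is_best_response where
  "is_best_response i f t x \<longleftrightarrow> is_arg_max (\<lambda>x. exp_util G i x f t) (\<lambda>x. x \<in> acts G i) x"

lemma is_best_response_in: "is_best_response i f t x \<Longrightarrow> x \<in> acts G i"
  by (simp add: is_best_response_def is_arg_max_def)

lemma best_response_exists:
  assumes i: "i \<in> players G" and f: "f \<in> other_strategies G i" and t: "t \<in> typs G i"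
  shows "\<exists>x. is_best_response i f t x"
proof -
  have "continuous_on (acts G i) (\<lambda>x. exp_util G i x f t)"
    unfolding continuous_on_sequentially comp_def
    using exp_util_tendsto[OF i t, where f = "\<lambda>_. f" and g = f] f by auto
  then obtain x where "x \<in> acts G i" "\<forall>y\<in>acts G i. exp_util G i y f t \<le> exp_util G i x f t"
    using continuous_attains_sup player_type_and_action_sets[OF i] by blast
  then show ?thesis by (auto simp: is_best_response_def is_arg_max_def not_less)
qed

lemma best_response_unique:
  assumes i: "i \<in> players G" and f: "f \<in> other_strategies G i" and t: "t \<in> typs G i"
    and "is_best_response i f t x" "y \<in> acts G i" "exp_util G i x f t \<le> exp_util G i y f t"
  shows "y = x"
  using strongly_concave_on_argmax_unique[OF exp_util_strongly_concave[OF i f t]] assms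
  by (simp add: is_best_response_def player_type_and_action_sets sigma_pos)

lemma is_best_response_inj:
  assumes i: "i \<in> players G" and f: "f \<in> other_strategies G i" and t: "t \<in> typs G i"
    and "is_best_response i f t x" "is_best_response i f t y"
  shows "x = y"
  using assms best_response_unique[OF i f t, of y x]
  by (metis is_best_response_def is_arg_max_linorder)

text \<open>The mean value theorem is applied to the difference of the two utilities as a function of the own action.
Hence a bound on the difference of the gradients bounds the difference of the gains of \<open>x\<close> over \<open>y\<close>.\<close>

lemma util_increment_diff_le:
  assumes i: "i \<in> players G" and x: "x \<in> acts G i" and y: "y \<in> acts G i"
    and a: "a \<in> other_acts G i" "b \<in> other_acts G i"
    and p: "p \<in> type_profiles G" "q \<in> type_profiles G"
    and C: "\<And>z. z \<in> acts G i \<Longrightarrow> norm (D i (a(i := z)) p - D i (b(i := z)) q) \<le> C"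
  shows "\<bar>(util G i (a(i := x)) p - util G i (a(i := y)) p) - (util G i (b(i := x)) q - util G i (b(i := y)) q)\<bar>
    \<le> C * norm (x - y)"
proof -
  have "\<bar>(util G i (a(i := x)) p - util G i (b(i := x)) q) - (util G i (a(i := y)) p - util G i (b(i := y)) q)\<bar>
    \<le> C * norm (x - y)"
  proof (rule bounded_gradient_imp_lipschitz[OF player_type_and_action_sets(5)[OF i] x y])
    fix z assume z: "z \<in> acts G i"
    show "((\<lambda>z. util G i (a(i := z)) p - util G i (b(i := z)) q) has_derivative
        (\<lambda>h. inner h (D i (a(i := z)) p - D i (b(i := z)) q))) (at z within acts G i)"
      unfolding inner_diff_right
      by (intro has_derivative_diff util_has_gradient i a p z)
  qed (rule C)
  then show ?thesis by (simp add: algebra_simps)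
qed

lemma best_response_dist_le:
  assumes i: "i \<in> players G" and f: "f \<in> other_strategies G i" "g \<in> other_strategies G i"
    and t: "s \<in> typs G i" "t \<in> typs G i"
    and x: "is_best_response i f s x" and y: "is_best_response i g t y"
    and diff: "(exp_util G i x f s - exp_util G i y f s) - (exp_util G i x g t - exp_util G i y g t)
      \<le> C * norm (x - y)" and C: "0 \<le> C"
  shows "\<sigma> i * norm (x - y) \<le> C"
  using strongly_concave_on_argmax_dist[OF exp_util_strongly_concave[OF i f(1) t(1)]
      exp_util_strongly_concave[OF i f(2) t(2)] player_type_and_action_sets(5)[OF i]
      x[unfolded is_best_response_def] y[unfolded is_best_response_def] diff C] .

text \<open>The expected gain of one action over another changes with the type for two reasons: the gradient depends on
the type, with a modulus whose conditional expectation is bounded, and so does the conditional law, in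
total variation. Neither estimate involves \<open>f\<close>, so \<open>L\<close> is uniform over the opponents' strategies.\<close>

lemma best_response_type_lipschitz:
  assumes i: "i \<in> players G"
  obtains L where "0 \<le> L" "\<And>f s t x y. f \<in> other_strategies G i \<Longrightarrow> s \<in> typs G i \<Longrightarrow> t \<in> typs G i \<Longrightarrow>
    is_best_response i f s x \<Longrightarrow> is_best_response i f t y \<Longrightarrow> norm (x - y) \<le> L * norm (s - t)"
proof -
  obtain K0 where K0: "\<And>a \<theta>. a \<in> act_profiles G \<Longrightarrow> \<theta> \<in> type_profiles G \<Longrightarrow> norm (D i a \<theta>) \<le> K0"
    using asm_C i by (fastforce simp: assumption_C_def bdd_above_def)
  (* K must be positive: it is the bound by which increments are scaled in total variation. *)
  define K where "K = max K0 1"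
  have K: "0 < K" "\<And>a \<theta>. a \<in> act_profiles G \<Longrightarrow> \<theta> \<in> type_profiles G \<Longrightarrow> norm (D i a \<theta>) \<le> K"
    using K0 by (auto simp: K_def max_def intro: order_trans)
  obtain \<nu> where \<nu>: "\<nu> \<in> borel_measurable (borel_on (other_types G i))"
      "\<forall>\<theta>\<in>other_types G i. 0 \<le> \<nu> \<theta>"
      "\<forall>a\<in>act_profiles G. \<forall>s\<in>typs G i. \<forall>t\<in>typs G i. \<forall>\<theta>\<in>other_types G i.
         norm (D i a (\<theta>(i := s)) - D i a (\<theta>(i := t))) \<le> \<nu> \<theta> * norm (s - t)"
      "(SUP t\<in>typs G i. \<integral>\<^sup>+ \<theta>. ennreal (\<nu> \<theta>) \<partial>cond G i t) < \<infinity>"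
    using bspec[OF asm_C[unfolded assumption_C_def] i] by (elim conjE exE) (rule that)
  obtain \<gamma> where \<gamma>: "0 < \<gamma>" "\<And>s t. s \<in> typs G i \<Longrightarrow> t \<in> typs G i \<Longrightarrow>
      tv_dist (cond G i s) (cond G i t) \<le> \<gamma> * norm (s - t)"
    using asm_C i unfolding assumption_C_def by blast
  define N where "N = enn2real (SUP t\<in>typs G i. \<integral>\<^sup>+ \<theta>. ennreal (\<nu> \<theta>) \<partial>cond G i t)"
  have N0: "0 \<le> N" by (simp add: N_def)
  have \<nu>_int: "integrable (cond G i t) \<nu>" "(\<integral>\<theta>. \<nu> \<theta> \<partial>cond G i t) \<le> N" if t: "t \<in> typs G i" for t
  proof -
    have le: "(\<integral>\<^sup>+ \<theta>. ennreal (\<nu> \<theta>) \<partial>cond G i t) \<le> ennreal N"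
      using \<nu>(4) t by (auto simp: N_def intro: SUP_upper)
    have pos: "AE \<theta> in cond G i t. 0 \<le> \<nu> \<theta>" by (rule AE_I2) (simp add: cond_prob_space[OF i t] \<nu>)
    have m: "\<nu> \<in> borel_measurable (cond G i t)" using \<nu>(1) by (simp add: measurable_cond[OF i t])
    show int: "integrable (cond G i t) \<nu>"
      by (rule integrableI_nonneg[OF m pos]) (use le in \<open>auto simp: order_le_less_trans\<close>)
    have "ennreal (\<integral>\<theta>. \<nu> \<theta> \<partial>cond G i t) \<le> ennreal N"
      using le nn_integral_eq_integral[OF int pos] by simp
    then show "(\<integral>\<theta>. \<nu> \<theta> \<partial>cond G i t) \<le> N" using N0 by simp
  qed
  define L where "L = (N + 2 * K * \<gamma>) / \<sigma> i"
  show thesis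
  proof (rule that[of L])
    show "0 \<le> L" using N0 K \<gamma> sigma_pos[OF i] by (simp add: L_def)
    fix f s t x y
    assume f: "f \<in> other_strategies G i" and s: "s \<in> typs G i" and t: "t \<in> typs G i"
      and x': "is_best_response i f s x" and y': "is_best_response i f t y"
    have x: "x \<in> acts G i" and y: "y \<in> acts G i"
      using x' y' by (auto simp: is_best_response_def is_arg_max_def)
    (* w r is the gain of x over y when the own type enters the utility as r. Below, the change of the
       expected gain from s to t is split into a change of the integrand under the law given s, and a
       change of the law for the integrand at t. *)
    define w where "w r \<theta> = payoff i x f r \<theta> - payoff i y f r \<theta>" for r \<theta>
    have w_int: "integrable (cond G i r') (w r)" if "r \<in> typs G i" "r' \<in> typs G i" for r r'
      unfolding w_def using that x y f i by (intro Bochner_Integration.integrable_diff payoff_integrable)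
    have w_eq: "exp_util G i x f r - exp_util G i y f r = (\<integral>\<theta>. w r \<theta> \<partial>cond G i r)" if "r \<in> typs G i" for r
      unfolding exp_util_eq_payoff w_def using that x y f i
      by (intro Bochner_Integration.integral_diff[symmetric] payoff_integrable)
    show "norm (x - y) \<le> L * norm (s - t)"
    proof (cases "x = y")
      case True
      then show ?thesis using \<open>0 \<le> L\<close> by simp
    next
      case False
      have diff: "\<bar>w s \<theta> - w t \<theta>\<bar> \<le> \<nu> \<theta> * (norm (s - t) * norm (x - y))" if \<theta>: "\<theta> \<in> other_types G i" for \<theta>
        using util_increment_diff_le[OF i x y play_others_in[OF f \<theta>] play_others_in[OF f \<theta>]
            type_profile_upd[OF i \<theta> s] type_profile_upd[OF i \<theta> t], of "\<nu> \<theta> * norm (s - t)"]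
          \<nu>(3) act_profile_upd[OF i play_others_in[OF f \<theta>]] s t \<theta>
        by (simp add: w_def payoff_def mult.assoc)
      have bound: "\<bar>w t \<theta>\<bar> \<le> K * norm (x - y)" if \<theta>: "\<theta> \<in> other_types G i" for \<theta>
        unfolding w_def payoff_def
        by (rule bounded_gradient_imp_lipschitz[OF player_type_and_action_sets(5)[OF i] x y
              util_has_gradient[OF i play_others_in[OF f \<theta>] type_profile_upd[OF i \<theta> t]]
              K(2)[OF act_profile_upd[OF i play_others_in[OF f \<theta>]] type_profile_upd[OF i \<theta> t]]])
      have "(\<integral>\<theta>. w s \<theta> \<partial>cond G i s) - (\<integral>\<theta>. w t \<theta> \<partial>cond G i s)
          = (\<integral>\<theta>. w s \<theta> - w t \<theta> \<partial>cond G i s)"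
        by (intro Bochner_Integration.integral_diff[symmetric] w_int s t)
      also have "\<dots> \<le> (\<integral>\<theta>. \<nu> \<theta> * (norm (s - t) * norm (x - y)) \<partial>cond G i s)"
        using diff cond_prob_space(3)[OF i s] abs_le_D1
        by (intro integral_mono Bochner_Integration.integrable_diff integrable_mult_left w_int \<nu>_int s t) auto
      also have "\<dots> = (\<integral>\<theta>. \<nu> \<theta> \<partial>cond G i s) * (norm (s - t) * norm (x - y))"
        by simp
      also have "\<dots> \<le> N * (norm (s - t) * norm (x - y))"
        by (intro mult_right_mono \<nu>_int s) auto
      finally have 1: "(\<integral>\<theta>. w s \<theta> \<partial>cond G i s) - (\<integral>\<theta>. w t \<theta> \<partial>cond G i s)
          \<le> N * (norm (s - t) * norm (x - y))" .
      have "\<bar>(\<integral>\<theta>. w t \<theta> \<partial>cond G i s) - (\<integral>\<theta>. w t \<theta> \<partial>cond G i t)\<bar>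
          \<le> 2 * (K * norm (x - y)) * tv_dist (cond G i s) (cond G i t)"
        using bound K(1) False w_int[OF t s]
        by (intro tv_dist_integral_diff_le) (auto simp: cond_prob_space i s t)
      also have "\<dots> \<le> 2 * (K * norm (x - y)) * (\<gamma> * norm (s - t))"
        using K(1) by (intro mult_left_mono \<gamma> s t) auto
      finally have 2: "(\<integral>\<theta>. w t \<theta> \<partial>cond G i s) - (\<integral>\<theta>. w t \<theta> \<partial>cond G i t)
          \<le> 2 * (K * norm (x - y)) * (\<gamma> * norm (s - t))" by linarith
      have "\<sigma> i * norm (x - y) \<le> (N + 2 * K * \<gamma>) * norm (s - t)"
      proof (rule best_response_dist_le[OF i f f s t x' y'])
        show "exp_util G i x f s - exp_util G i y f s - (exp_util G i x f t - exp_util G i y f t)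
            \<le> (N + 2 * K * \<gamma>) * norm (s - t) * norm (x - y)"
          unfolding w_eq[OF s] w_eq[OF t] using 1 2 by (simp add: algebra_simps)
      qed (use N0 K \<gamma> in auto)
      then show ?thesis using sigma_pos[OF i] by (simp add: L_def field_simps)
    qed
  qed
qed

text \<open>With the own type fixed the law is fixed as well, so the gains are compared pointwise under one
integral, where the gradients differ by at most \<open>\<Sum>\<^sub>j \<tau>\<^sub>i\<^sub>j e\<^sub>j\<close>.\<close>

lemma best_response_strategy_lipschitz:
  assumes i: "i \<in> players G" and f: "f \<in> other_strategies G i" and g: "g \<in> other_strategies G i"
    and t: "t \<in> typs G i"
    and x': "is_best_response i f t x" and y': "is_best_response i g t y"
    and e: "\<And>j s. j \<in> others G i \<Longrightarrow> s \<in> typs G j \<Longrightarrow> norm (f j s - g j s) \<le> e j"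
      "\<And>j. j \<in> others G i \<Longrightarrow> 0 \<le> e j"
  shows "\<sigma> i * norm (x - y) \<le> (\<Sum>j\<in>others G i. \<tau> i j * e j)"
proof -
  let ?C = "\<Sum>j\<in>others G i. \<tau> i j * e j"
  have x: "x \<in> acts G i" and y: "y \<in> acts G i"
    using x' y' by (auto simp: is_best_response_def is_arg_max_def)
  have \<tau>: "0 \<le> \<tau> i j" if "j \<in> others G i" for j
    using asm_B i that by (simp add: assumption_B_def)
  (* The gain of x over y against h; only the opponents' actions differ between f and g. *)
  define w where "w h \<theta> = payoff i x h t \<theta> - payoff i y h t \<theta>" for h \<theta>
  have w_int: "integrable (cond G i t) (w h)" if "h \<in> other_strategies G i" for h
    unfolding w_def using that x y i t by (intro Bochner_Integration.integrable_diff payoff_integrable)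
  have w_eq: "exp_util G i x h t - exp_util G i y h t = (\<integral>\<theta>. w h \<theta> \<partial>cond G i t)"
    if "h \<in> other_strategies G i" for h
    unfolding exp_util_eq_payoff w_def using that x y i t
    by (intro Bochner_Integration.integral_diff[symmetric] payoff_integrable)
  have diff: "w f \<theta> - w g \<theta> \<le> ?C * norm (x - y)" if \<theta>: "\<theta> \<in> other_types G i" for \<theta>
  proof -
    note pf = play_others_in[OF f \<theta>] and pg = play_others_in[OF g \<theta>] and tp = type_profile_upd[OF i \<theta> t]
    have "\<bar>w f \<theta> - w g \<theta>\<bar> \<le> ?C * norm (x - y)"
      unfolding w_def payoff_def
    proof (rule util_increment_diff_le[OF i x y pf pg tp tp])
      fix z assume "z \<in> acts G i"
      then have "norm (D i ((play_others G i f \<theta>)(i := z)) (\<theta>(i := t)) - D i ((play_others G i g \<theta>)(i := z)) (\<theta>(i := t)))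
          \<le> (\<Sum>j\<in>others G i. \<tau> i j * norm (play_others G i f \<theta> j - play_others G i g \<theta> j))"
        using asm_B i pf pg tp unfolding assumption_B_def by blast
      also have "\<dots> \<le> ?C"
        using \<theta> by (intro sum_mono mult_left_mono \<tau>) (auto simp: play_others_def other_types_def intro!: e)
      finally show "norm (D i ((play_others G i f \<theta>)(i := z)) (\<theta>(i := t)) - D i ((play_others G i g \<theta>)(i := z)) (\<theta>(i := t))) \<le> ?C" .
    qed
    then show ?thesis by linarith
  qed
  interpret prob_space "cond G i t" using cond_prob_space i t by blast
  have "(\<integral>\<theta>. w f \<theta> \<partial>cond G i t) - (\<integral>\<theta>. w g \<theta> \<partial>cond G i t) = (\<integral>\<theta>. w f \<theta> - w g \<theta> \<partial>cond G i t)"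
    by (intro Bochner_Integration.integral_diff[symmetric] w_int f g)
  also have "\<dots> \<le> ?C * norm (x - y)"
    by (intro integral_le_const Bochner_Integration.integrable_diff w_int f g AE_I2 diff)
      (simp add: cond_prob_space[OF i t])
  finally have "(\<integral>\<theta>. w f \<theta> \<partial>cond G i t) - (\<integral>\<theta>. w g \<theta> \<partial>cond G i t) \<le> ?C * norm (x - y)" .
  then show ?thesis
    using w_eq f g by (intro best_response_dist_le[OF i f g t t x' y'] sum_nonneg mult_nonneg_nonneg \<tau> e) auto
qed

section \<open>The best-response map and its fixed points\<close>

lemma restrict_strategies:
  "i \<in> players G \<Longrightarrow> f \<in> strategy_profiles G \<Longrightarrow> restrict f (others G i) \<in> other_strategies G i"
  by (auto simp: strategy_profiles_def other_strategies_def others_def PiE_iff)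

definition best_response where
  "best_response f i t = (SOME x. is_best_response i (restrict f (others G i)) t x)"

definition response where
  "response f = (\<lambda>i\<in>players G. \<lambda>t\<in>typs G i. best_response f i t)"

lemma is_best_response_response:
  assumes "f \<in> strategy_profiles G" "i \<in> players G" "t \<in> typs G i"
  shows "is_best_response i (restrict f (others G i)) t (response f i t)"
  using someI_ex[OF best_response_exists[OF assms(2) restrict_strategies[OF assms(2,1)] assms(3)]] assms
  by (simp add: response_def best_response_def)

lemma response_lipschitz:
  assumes i: "i \<in> players G"
  obtains L where "\<And>f. f \<in> strategy_profiles G \<Longrightarrow> L-lipschitz_on (typs G i) (response f i)"
proof -
  obtain L where L: "0 \<le> L" "\<And>f s t x y. f \<in> other_strategies G i \<Longrightarrow> s \<in> typs G i \<Longrightarrow> t \<in> typs G i \<Longrightarrow>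
      is_best_response i f s x \<Longrightarrow> is_best_response i f t y \<Longrightarrow> norm (x - y) \<le> L * norm (s - t)"
    using best_response_type_lipschitz[OF i] by blast
  show thesis
    by (rule that[of L], rule lipschitz_onI)
      (auto simp: dist_norm L(1) intro!: L(2) restrict_strategies is_best_response_response i)
qed

text \<open>Best responses are measurable in the type because they are Lipschitz.\<close>

lemma response_in_strategy_profiles:
  assumes f: "f \<in> strategy_profiles G"
  shows "response f \<in> strategy_profiles G"
proof -
  have "response f i \<in> strategies G i" if i: "i \<in> players G" for i
  proof -
    obtain L where "L-lipschitz_on (typs G i) (response f i)"
      using response_lipschitz[OF i] f by blast
    then have "response f i \<in> borel_measurable (borel_on (typs G i))"
      by (intro borel_measurable_continuous_on_restrict lipschitz_on_continuous_on)
    moreover have "response f i t \<in> acts G i" if "t \<in> typs G i" for t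
      using is_best_response_in[OF is_best_response_response[OF f i that]] .
    moreover have "response f i \<in> extensional (typs G i)" using i by (simp add: response_def)
    ultimately show ?thesis
      by (auto simp: strategies_def measurable_restrict_space2_iff space_restrict_space)
  qed
  then show ?thesis by (simp add: strategy_profiles_def PiE_iff response_def)
qed

lemma constant_profile:
  assumes "\<And>i. i \<in> players G \<Longrightarrow> c i \<in> acts G i"
  shows "(\<lambda>i\<in>players G. \<lambda>t\<in>typs G i. c i) \<in> strategy_profiles G"
proof -
  have "(\<lambda>t\<in>typs G i. c i) \<in> strategies G i" if "i \<in> players G" for i
  proof -
    have "(\<lambda>t\<in>typs G i. c i) \<in> measurable (borel_on (typs G i)) (borel_on (acts G i))
        \<longleftrightarrow> (\<lambda>t. c i) \<in> measurable (borel_on (typs G i)) (borel_on (acts G i))"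
      by (rule measurable_cong) (simp add: space_restrict_space)
    then show ?thesis using assms[OF that] by (simp add: strategies_def space_restrict_space)
  qed
  then show ?thesis by (simp add: strategy_profiles_def PiE_iff)
qed

lemma profile_eqI:
  assumes "f \<in> strategy_profiles G" "g \<in> strategy_profiles G"
    and "\<And>i t. i \<in> players G \<Longrightarrow> t \<in> typs G i \<Longrightarrow> f i t = g i t"
  shows "f = g"
  using strategy_profiles_le_iff[OF assms(1,2)] strategy_profiles_le_iff[OF assms(2,1)] assms(3)
  by (simp add: antisym)

lemma BNE_iff_response_fixpoint: "f \<in> BNE G \<longleftrightarrow> f \<in> strategy_profiles G \<and> response f = f"
proof
  assume f: "f \<in> BNE G"
  then have fp: "f \<in> strategy_profiles G" by (simp add: BNE_def)
  have "response f = f"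
  proof (rule profile_eqI[OF response_in_strategy_profiles[OF fp] fp])
    fix i t assume i: "i \<in> players G" and t: "t \<in> typs G i"
    have "is_best_response i (restrict f (others G i)) t (f i t)"
      using f i t by (simp add: BNE_def is_best_response_def)
    then show "response f i t = f i t"
      by (intro is_best_response_inj[OF i restrict_strategies[OF i fp] t] is_best_response_response fp i t)
  qed
  with fp show "f \<in> strategy_profiles G \<and> response f = f" by simp
next
  assume "f \<in> strategy_profiles G \<and> response f = f"
  then show "f \<in> BNE G"
    using is_best_response_response[of f] by (simp add: BNE_def is_best_response_def)
qed

lemma BNE_lipschitz:
  obtains L where "\<And>f i. f \<in> BNE G \<Longrightarrow> i \<in> players G \<Longrightarrow> L-lipschitz_on (typs G i) (f i)"
proof -
  have "\<exists>L. \<forall>f\<in>strategy_profiles G. L-lipschitz_on (typs G i) (response f i)" if "i \<in> players G" for i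
    by (rule response_lipschitz[OF that]) blast
  then obtain L :: "nat \<Rightarrow> real" where L: "\<And>i f. i \<in> players G \<Longrightarrow> f \<in> strategy_profiles G \<Longrightarrow>
      (L i)-lipschitz_on (typs G i) (response f i)"
    by metis
  have fin: "finite (players G)" by (simp add: players_def)
  show thesis
  proof (rule that[of "\<Sum>i\<in>players G. \<bar>L i\<bar>"])
    fix f i assume f: "f \<in> BNE G" and i: "i \<in> players G"
    have "(L i)-lipschitz_on (typs G i) (f i)"
      using L[OF i, of f] f by (simp add: BNE_iff_response_fixpoint)
    moreover have "L i \<le> (\<Sum>i\<in>players G. \<bar>L i\<bar>)"
      using member_le_sum[OF i, of "\<lambda>i. \<bar>L i\<bar>"] fin by auto
    ultimately show "(\<Sum>i\<in>players G. \<bar>L i\<bar>)-lipschitz_on (typs G i) (f i)"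
      by (rule lipschitz_on_le)
  qed
qed

text \<open>The optimality inequality at each step passes to the limit by \<open>exp_util_tendsto\<close>.\<close>

lemma response_iterates_limit_BNE:
  assumes f: "\<And>k. f k \<in> strategy_profiles G" and step: "\<And>k. f (Suc k) = response (f k)"
    and conv: "\<And>i t. i \<in> players G \<Longrightarrow> t \<in> typs G i \<Longrightarrow> convergent (\<lambda>k. f k i t)"
  obtains F where "F \<in> BNE G" "\<And>i t. i \<in> players G \<Longrightarrow> t \<in> typs G i \<Longrightarrow> (\<lambda>k. f k i t) \<longlonglongrightarrow> F i t"
proof -
  define F where "F = (\<lambda>i\<in>players G. \<lambda>t\<in>typs G i. lim (\<lambda>k. f k i t))"
  have F: "(\<lambda>k. f k i t) \<longlonglongrightarrow> F i t" if "i \<in> players G" "t \<in> typs G i" for i t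
    using conv[OF that] that by (simp add: F_def convergent_LIMSEQ_iff)
  have f_str: "f k i \<in> strategies G i" if "i \<in> players G" for k i
    using f that by (auto simp: strategy_profiles_def)
  have f_in: "f k i t \<in> acts G i" if "i \<in> players G" "t \<in> typs G i" for k i t
    using strategies_maps[OF f_str] that .
  have F_in: "F i t \<in> acts G i" if "i \<in> players G" "t \<in> typs G i" for i t
    using closed_sequentially[OF compact_imp_closed[OF player_type_and_action_sets(4)[OF that(1)]] _ F[OF that]] f_in that by auto
  have "F i \<in> strategies G i" if i: "i \<in> players G" for i
  proof -
    have "F i \<in> borel_measurable (borel_on (typs G i))"
    proof (rule borel_measurable_LIMSEQ_metric)
      show "f k i \<in> borel_measurable (borel_on (typs G i))" for k
        using f_str[OF i] by (auto simp: strategies_def measurable_restrict_space2_iff)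
      show "(\<lambda>k. f k i t) \<longlonglongrightarrow> F i t" if "t \<in> space (borel_on (typs G i))" for t
        using F[OF i] that by (simp add: space_restrict_space)
    qed
    then show ?thesis
      using i F_in by (auto simp: strategies_def measurable_restrict_space2_iff space_restrict_space F_def)
  qed
  then have FP: "F \<in> strategy_profiles G" by (simp add: strategy_profiles_def PiE_iff F_def)
  have "F \<in> BNE G"
    unfolding BNE_def
  proof (intro CollectI conjI ballI FP)
    fix i t assume i: "i \<in> players G" and t: "t \<in> typs G i"
    let ?r = "\<lambda>f. restrict f (others G i)"
    have lim: "(\<lambda>k. exp_util G i (x k) (?r (f k)) t) \<longlonglongrightarrow> exp_util G i y (?r F) t"
      if "\<And>k. x k \<in> acts G i" "y \<in> acts G i" "x \<longlonglongrightarrow> y" for x y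
      using that by (intro exp_util_tendsto i t restrict_strategies f FP) (auto intro: F others_player)
    have "exp_util G i y (?r F) t \<le> exp_util G i (F i t) (?r F) t" if y: "y \<in> acts G i" for y
    proof (rule LIMSEQ_le)
      show "(\<lambda>k. exp_util G i y (?r (f k)) t) \<longlonglongrightarrow> exp_util G i y (?r F) t"
        using y by (intro lim) auto
      (* The optimal action against f k is f (Suc k) i t, which has the same limit as f k i t. *)
      show "(\<lambda>k. exp_util G i (f (Suc k) i t) (?r (f k)) t) \<longlonglongrightarrow> exp_util G i (F i t) (?r F) t"
        by (intro lim f_in F_in i t LIMSEQ_Suc[OF F])
      have "exp_util G i y (?r (f k)) t \<le> exp_util G i (f (Suc k) i t) (?r (f k)) t" for k
        using is_best_response_response[OF f i t] y
        by (auto simp: step is_best_response_def is_arg_max_linorder)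
      then show "\<exists>N. \<forall>k\<ge>N. exp_util G i y (?r (f k)) t \<le> exp_util G i (f (Suc k) i t) (?r (f k)) t" by blast
    qed
    then show "is_arg_max (\<lambda>x. exp_util G i x (?r F) t) (\<lambda>x. x \<in> acts G i) (F i t)"
      using F_in[OF i t] by (simp add: is_arg_max_linorder)
  qed
  then show thesis using F that by blast
qed

text \<open>Apply \<open>best_response_strategy_lipschitz\<close> to the two equilibria, with \<open>e\<close> the vector of uniform distances of
their components; dividing by \<open>\<sigma> i\<close> shows that \<open>e\<close> is subinvariant under the interaction matrix.\<close>

lemma BNE_unique_if_spectral_radius_less_1:
  assumes rho: "spectral_radius (map_mat complex_of_real (interaction_matrix G \<sigma> \<tau>)) < 1"
    and f: "f \<in> BNE G" and g: "g \<in> BNE G"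
  shows "f = g"
proof -
  have fp: "f \<in> strategy_profiles G" and gp: "g \<in> strategy_profiles G"
    using f g by (auto simp: BNE_def)
  have in_acts: "h i t \<in> acts G i" if "h \<in> strategy_profiles G" "i \<in> players G" "t \<in> typs G i" for h i t
    using that by (intro strategies_maps[OF _ that(3)]) (auto simp: strategy_profiles_def)
  define e where "e i = (SUP t\<in>typs G i. norm (f i t - g i t))" for i
  have le_e: "norm (f i t - g i t) \<le> e i" if i: "i \<in> players G" and t: "t \<in> typs G i" for i t
  proof -
    (* Compactness of the action set makes the supremum defining e i a finite bound. *)
    obtain B where B: "\<forall>x\<in>acts G i. norm x \<le> B"
      using compact_imp_bounded[OF player_type_and_action_sets(4)[OF i]] by (auto simp: bounded_iff)
    have "norm (f i s - g i s) \<le> B + B" if "s \<in> typs G i" for s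
      using B in_acts[OF fp i that] in_acts[OF gp i that]
      by (intro order_trans[OF norm_triangle_ineq4] add_mono) auto
    then show ?thesis
      unfolding e_def by (intro cSUP_upper t bdd_aboveI2[of _ _ "B + B"])
  qed
  have e0: "0 \<le> e i" if i: "i \<in> players G" for i
    using le_e[OF i] player_type_and_action_sets(1)[OF i] by (meson ex_in_conv norm_ge_zero order_trans)
  define m where "m i j = (if i = j then 0 else \<tau> i j / \<sigma> i)" for i j
  have sub: "e i \<le> (\<Sum>j<nplayers G. m i j * e j)" if i: "i \<in> players G" for i
    unfolding e_def[of i]
  proof (rule cSUP_least)
    show "typs G i \<noteq> {}" by (rule player_type_and_action_sets(1)[OF i])
    fix t assume t: "t \<in> typs G i"
    have best: "is_best_response i (restrict h (others G i)) t (h i t)" if "h \<in> BNE G" for h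
      using that i t by (simp add: BNE_def is_best_response_def)
    have "\<sigma> i * norm (f i t - g i t) \<le> (\<Sum>j\<in>others G i. \<tau> i j * e j)"
      by (rule best_response_strategy_lipschitz[OF i restrict_strategies[OF i fp]
            restrict_strategies[OF i gp] t best[OF f] best[OF g]])
        (auto intro!: le_e e0 others_player)
    then have "norm (f i t - g i t) \<le> (\<Sum>j\<in>others G i. \<tau> i j * e j) / \<sigma> i"
      using sigma_pos[OF i] by (simp add: field_simps)
    also have "\<dots> = (\<Sum>j\<in>others G i. m i j * e j)"
      by (auto simp: sum_divide_distrib m_def others_def intro!: sum.cong)
    also have "\<dots> = (\<Sum>j<nplayers G. m i j * e j)"
      by (rule sum.mono_neutral_left) (auto simp: others_def players_def m_def)
    finally show "norm (f i t - g i t) \<le> (\<Sum>j<nplayers G. m i j * e j)" .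
  qed
  have e_zero: "e i = 0" if i: "i \<in> players G" for i
  proof (rule subinvariant_vector_zero[of "nplayers G" m e])
    show "0 < nplayers G" using game by (simp add: is_bayesian_game_def)
    have "map_mat complex_of_real (interaction_matrix G \<sigma> \<tau>)
        = mat (nplayers G) (nplayers G) (\<lambda>(i, j). complex_of_real (m i j))"
      by (rule eq_matI) (auto simp: interaction_matrix_def m_def)
    with rho show "spectral_radius (mat (nplayers G) (nplayers G) (\<lambda>(i, j). complex_of_real (m i j))) < 1"
      by simp
    show "0 \<le> m i j" if "i < nplayers G" "j < nplayers G" for i j
      using that asm_B sigma_pos[of i]
      by (auto simp: m_def assumption_B_def others_def players_def intro!: divide_nonneg_pos)
  qed (use i e0 sub in \<open>auto simp: players_def\<close>)
  show "f = g"
    using le_e e_zero by (intro profile_eqI fp gp) fastforce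
qed

end

section \<open>Order structure of the equilibria\<close>

locale supermodular_bayesian_game = smooth_bayesian_game +
  assumes asm_D: "assumption_D G"
    and quasi_supermodular:
      "\<forall>i\<in>players G. \<forall>f\<in>other_strategies G i. \<forall>t\<in>typs G i.
         weakly_quasi_supermodular (acts G i) (\<lambda>x. exp_util G i x f t)"
    and single_crossing:
      "\<forall>i\<in>players G. \<forall>t\<in>typs G i.
         weak_single_crossing (acts G i) (other_strategies G i) (\<lambda>x f. exp_util G i x f t)"
begin

text \<open>Opponents' strategies and own type may change together, so that single crossing in the strategies and
single crossing in the type both enter through the same hypothesis.\<close>

lemma best_response_mono:
  assumes i: "i \<in> players G" and f: "f \<in> other_strategies G i" "g \<in> other_strategies G i"
    and t: "s \<in> typs G i" "t \<in> typs G i"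
    and crossing: "\<And>x x'. x \<in> acts G i \<Longrightarrow> x' \<in> acts G i \<Longrightarrow> x \<le> x' \<Longrightarrow>
      exp_util G i x f s \<le> exp_util G i x' f s \<Longrightarrow> exp_util G i x g t \<le> exp_util G i x' g t"
    and x: "is_best_response i f s x" and y: "is_best_response i g t y"
  shows "x \<le> y"
proof (rule argmax_mono)
  show "weakly_quasi_supermodular (acts G i) (\<lambda>x. exp_util G i x g t)"
    using quasi_supermodular i f t by blast
  show "is_arg_max (\<lambda>x. exp_util G i x f s) (\<lambda>x. x \<in> acts G i) x"
    using x by (simp add: is_best_response_def)
  show "sup u v \<in> acts G i \<and> inf u v \<in> acts G i" if "u \<in> acts G i" "v \<in> acts G i" for u v
    using that asm_D i by (simp add: assumption_D_def)
  show "y \<in> acts G i" using is_best_response_in y .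
qed (use crossing best_response_unique[OF i f(2) t(2) y] in auto)

lemma response_mono:
  assumes f: "f \<in> strategy_profiles G" "g \<in> strategy_profiles G" and le: "f \<le> g"
  shows "response f \<le> response g"
proof -
  have "response f i t \<le> response g i t" if i: "i \<in> players G" and t: "t \<in> typs G i" for i t
  proof (rule best_response_mono[OF i restrict_strategies[OF i f(1)] restrict_strategies[OF i f(2)] t t])
    have "restrict f (others G i) \<le> restrict g (others G i)"
      using le by (auto simp: le_fun_def)
    then show "exp_util G i x (restrict g (others G i)) t \<le> exp_util G i x' (restrict g (others G i)) t"
      if "x \<in> acts G i" "x' \<in> acts G i" "x \<le> x'"
        "exp_util G i x (restrict f (others G i)) t \<le> exp_util G i x' (restrict f (others G i)) t" for x x'
      using that single_crossing i t restrict_strategies[OF i f(1)] restrict_strategies[OF i f(2)]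
      unfolding weak_single_crossing_def by blast
  qed (intro is_best_response_response f i t)+
  then show ?thesis
    using strategy_profiles_le_iff[OF response_in_strategy_profiles[OF f(1)] response_in_strategy_profiles[OF f(2)]]
    by simp
qed

lemma response_preserves_type_monotonicity:
  assumes own: "own_type_single_crossing G" and f: "f \<in> strategy_profiles G"
    and mono: "\<And>j. j \<in> players G \<Longrightarrow> mono_on (typs G j) (f j)" and i: "i \<in> players G"
  shows "mono_on (typs G i) (response f i)"
proof (rule mono_onI)
  fix s t assume t: "s \<in> typs G i" "t \<in> typs G i" and le: "s \<le> t"
  have r: "restrict f (others G i) \<in> other_strategies G i" by (rule restrict_strategies[OF i f])
  have "restrict f (others G i) \<in> other_incr_strategies G i"
    using r mono by (auto simp: other_strategies_def other_incr_strategies_def incr_strategies_def PiE_iff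
        others_def)
  then have crossing: "weak_single_crossing (acts G i) (typs G i)
      (\<lambda>x t. exp_util G i x (restrict f (others G i)) t)"
    using own i unfolding own_type_single_crossing_def by blast
  show "response f i s \<le> response f i t"
  proof (rule best_response_mono[OF i r r t])
    show "exp_util G i x (restrict f (others G i)) t \<le> exp_util G i x' (restrict f (others G i)) t"
      if "x \<in> acts G i" "x' \<in> acts G i" "x \<le> x'"
        "exp_util G i x (restrict f (others G i)) s \<le> exp_util G i x' (restrict f (others G i)) s" for x x'
      using that crossing t le unfolding weak_single_crossing_def by blast
  qed (intro is_best_response_response f i t)+
qed

text \<open>One statement serves both extremal equilibria: from a profile above all others, the iterates decrease to the
greatest equilibrium, and from a profile below all others they increase to the least one. Comparison
with an equilibrium, a fixed point, survives every step by isotonicity, and the limit because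
the order is closed.\<close>

lemma response_iteration:
  assumes f0: "f0 \<in> strategy_profiles G" and start: "f0 \<le> response f0 \<or> response f0 \<le> f0"
  obtains F where "F \<in> BNE G"
    "\<And>g. g \<in> BNE G \<Longrightarrow> g \<le> f0 \<Longrightarrow> g \<le> F" "\<And>g. g \<in> BNE G \<Longrightarrow> f0 \<le> g \<Longrightarrow> F \<le> g"
    "\<And>i. own_type_single_crossing G \<Longrightarrow> (\<And>j. j \<in> players G \<Longrightarrow> mono_on (typs G j) (f0 j)) \<Longrightarrow>
       i \<in> players G \<Longrightarrow> mono_on (typs G i) (F i)"
proof -
  define f where "f k = (response ^^ k) f0" for k
  have f_0: "f 0 = f0" and f_Suc: "f (Suc k) = response (f k)" for k by (simp_all add: f_def)
  have fp: "f k \<in> strategy_profiles G" for k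
    by (induction k) (simp_all add: f_0 f_Suc f0 response_in_strategy_profiles)
  have steps: "(\<forall>k. f k \<le> f (Suc k)) \<or> (\<forall>k. f (Suc k) \<le> f k)"
    using start
  proof
    assume "f0 \<le> response f0"
    then have "f k \<le> f (Suc k)" for k
      by (induction k) (simp_all add: f_0 f_Suc
          response_mono[OF fp response_in_strategy_profiles[OF fp]])
    then show ?thesis by blast
  next
    assume "response f0 \<le> f0"
    then have "f (Suc k) \<le> f k" for k
      by (induction k) (simp_all add: f_0 f_Suc
          response_mono[OF response_in_strategy_profiles[OF fp] fp])
    then show ?thesis by blast
  qed
  have conv: "convergent (\<lambda>k. f k i t)" if i: "i \<in> players G" and t: "t \<in> typs G i" for i t
  proof (rule bounded_monotone_vec_convergent)
    have "f k i \<in> strategies G i" for k using fp i by (auto simp: strategy_profiles_def)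
    then have "range (\<lambda>k. f k i t) \<subseteq> acts G i" using strategies_maps t by blast
    then show "bounded (range (\<lambda>k. f k i t))"
      using compact_imp_bounded[OF player_type_and_action_sets(4)[OF i]] bounded_subset by blast
    show "(\<forall>k. f k i t \<le> f (Suc k) i t) \<or> (\<forall>k. f (Suc k) i t \<le> f k i t)"
      using steps by (auto simp: le_fun_def)
  qed
  obtain F where F: "F \<in> BNE G" "\<And>i t. i \<in> players G \<Longrightarrow> t \<in> typs G i \<Longrightarrow> (\<lambda>k. f k i t) \<longlonglongrightarrow> F i t"
    using response_iterates_limit_BNE[of f, OF fp f_Suc conv] by blast
  have Fp: "F \<in> strategy_profiles G" using F(1) by (simp add: BNE_def)
  show thesis
  proof (rule that[OF F(1)])
    fix g assume g: "g \<in> BNE G"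
    then have gp: "g \<in> strategy_profiles G" and gfix: "response g = g"
      by (simp_all add: BNE_iff_response_fixpoint)
    show "g \<le> F" if "g \<le> f0"
    proof -
      have "g \<le> f k" for k
        by (induction k) (use that gfix response_mono[OF gp fp] in \<open>auto simp: f_0 f_Suc\<close>)
      then show ?thesis
        unfolding strategy_profiles_le_iff[OF gp Fp]
        by (intro ballI LIMSEQ_le_vec[OF tendsto_const F(2)]) (auto simp: le_fun_def)
    qed
    show "F \<le> g" if "f0 \<le> g"
    proof -
      have "f k \<le> g" for k
        by (induction k) (use that gfix response_mono[OF fp gp] in \<open>auto simp: f_0 f_Suc\<close>)
      then show ?thesis
        unfolding strategy_profiles_le_iff[OF Fp gp]
        by (intro ballI LIMSEQ_le_vec[OF F(2) tendsto_const]) (auto simp: le_fun_def)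
    qed
  next
    fix i assume own: "own_type_single_crossing G" and i: "i \<in> players G"
      and mono: "\<And>j. j \<in> players G \<Longrightarrow> mono_on (typs G j) (f0 j)"
    have "\<forall>j\<in>players G. mono_on (typs G j) (f k j)" for k
      by (induction k)
        (auto simp: f_0 f_Suc mono intro: response_preserves_type_monotonicity[OF own fp])
    then have fmono: "f k i s \<le> f k i t" if "s \<in> typs G i" "t \<in> typs G i" "s \<le> t" for k s t
      using i that by (meson mono_onD)
    show "mono_on (typs G i) (F i)"
      by (intro mono_onI LIMSEQ_le_vec[OF F(2)[OF i] F(2)[OF i]] fmono)
  qed
qed

lemma greatest_BNE_exists:
  obtains F where "greatest_in (BNE G) F"
    "own_type_single_crossing G \<Longrightarrow> \<forall>i\<in>players G. mono_on (typs G i) (F i)"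
proof -
  have "\<exists>m\<in>acts G i. \<forall>x\<in>acts G i. x \<le> m" if i: "i \<in> players G" for i
    using compact_sup_closed_has_greatest[of "acts G i"] player_type_and_action_sets[OF i] asm_D i
    unfolding assumption_D_def by metis
  then obtain c where c: "\<And>i. i \<in> players G \<Longrightarrow> c i \<in> acts G i"
    "\<And>i x. i \<in> players G \<Longrightarrow> x \<in> acts G i \<Longrightarrow> x \<le> c i" by metis
  define f0 where "f0 = (\<lambda>i\<in>players G. \<lambda>t\<in>typs G i. c i)"
  have f0: "f0 \<in> strategy_profiles G" unfolding f0_def by (rule constant_profile[OF c(1)])
  have top: "g \<le> f0" if g: "g \<in> strategy_profiles G" for g
    unfolding strategy_profiles_le_iff[OF g f0]
    using g by (auto simp: f0_def strategy_profiles_def intro!: c strategies_maps)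
  have mono: "mono_on (typs G i) (f0 i)" if "i \<in> players G" for i
    using that by (auto simp: f0_def intro!: mono_onI)
  obtain F where F: "F \<in> BNE G" "\<And>g. g \<in> BNE G \<Longrightarrow> g \<le> f0 \<Longrightarrow> g \<le> F"
    "\<And>i. own_type_single_crossing G \<Longrightarrow> i \<in> players G \<Longrightarrow> mono_on (typs G i) (F i)"
    using response_iteration[OF f0] top[OF response_in_strategy_profiles[OF f0]] mono by metis
  show thesis
    using F top by (intro that[of F]) (auto simp: greatest_in_def BNE_def)
qed

lemma least_BNE_exists:
  obtains F where "least_in (BNE G) F"
    "own_type_single_crossing G \<Longrightarrow> \<forall>i\<in>players G. mono_on (typs G i) (F i)"
proof -
  have "\<exists>m\<in>acts G i. \<forall>x\<in>acts G i. m \<le> x" if i: "i \<in> players G" for i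
    using compact_inf_closed_has_least[of "acts G i"] player_type_and_action_sets[OF i] asm_D i
    unfolding assumption_D_def by metis
  then obtain c where c: "\<And>i. i \<in> players G \<Longrightarrow> c i \<in> acts G i"
    "\<And>i x. i \<in> players G \<Longrightarrow> x \<in> acts G i \<Longrightarrow> c i \<le> x" by metis
  define f0 where "f0 = (\<lambda>i\<in>players G. \<lambda>t\<in>typs G i. c i)"
  have f0: "f0 \<in> strategy_profiles G" unfolding f0_def by (rule constant_profile[OF c(1)])
  have bot: "f0 \<le> g" if g: "g \<in> strategy_profiles G" for g
    unfolding strategy_profiles_le_iff[OF f0 g]
    using g by (auto simp: f0_def strategy_profiles_def intro!: c strategies_maps)
  have mono: "mono_on (typs G i) (f0 i)" if "i \<in> players G" for i
    using that by (auto simp: f0_def intro!: mono_onI)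
  obtain F where F: "F \<in> BNE G" "\<And>g. g \<in> BNE G \<Longrightarrow> f0 \<le> g \<Longrightarrow> F \<le> g"
    "\<And>i. own_type_single_crossing G \<Longrightarrow> i \<in> players G \<Longrightarrow> mono_on (typs G i) (F i)"
    using response_iteration[OF f0] bot[OF response_in_strategy_profiles[OF f0]] mono by metis
  show thesis
    using F bot by (intro that[of F]) (auto simp: least_in_def BNE_def)
qed

end

theorem theorem5p1:
  fixes G :: "('d::finite, 'z::finite) bayesian_game"
    and D :: "nat \<Rightarrow> (nat \<Rightarrow> real ^ 'z) \<Rightarrow> (nat \<Rightarrow> real ^ 'd) \<Rightarrow> real ^ 'z"
    and \<sigma> :: "nat \<Rightarrow> real" and \<tau> :: "nat \<Rightarrow> nat \<Rightarrow> real"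
  assumes game: "is_bayesian_game G"
    and gradient: "own_gradient G D"
    and asm_A: "assumption_A G D"
    and asm_B: "assumption_B G D \<sigma> \<tau>"
    and asm_C: "assumption_C G D"
    and asm_D: "assumption_D G"
    and quasi_supermodular:
      "\<forall>i\<in>players G. \<forall>f\<in>other_strategies G i. \<forall>t\<in>typs G i.
         weakly_quasi_supermodular (acts G i) (\<lambda>x. exp_util G i x f t)"
    and single_crossing:
      "\<forall>i\<in>players G. \<forall>t\<in>typs G i.
         weak_single_crossing (acts G i) (other_strategies G i) (\<lambda>x f. exp_util G i x f t)"
  shows
    "\<exists>fmax fmin.
       (greatest_in (BNE G) fmax \<and> least_in (BNE G) fmin \<and>
        (\<exists>L. \<forall>i\<in>players G. L-lipschitz_on (typs G i) (fmax i) \<and> L-lipschitz_on (typs G i) (fmin i)))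
     \<and> (own_type_single_crossing G \<longrightarrow>
        (\<forall>i\<in>players G. mono_on (typs G i) (fmax i) \<and> mono_on (typs G i) (fmin i)))
     \<and> (own_type_single_crossing G \<and>
        spectral_radius (map_mat complex_of_real (interaction_matrix G \<sigma> \<tau>)) < 1 \<longrightarrow>
        fmax = fmin \<and> (\<exists>!f. f \<in> BNE G))"
proof -
  interpret supermodular_bayesian_game G D \<sigma> \<tau>
    by unfold_locales (fact assms)+
  obtain fmax where fmax: "greatest_in (BNE G) fmax"
    "own_type_single_crossing G \<Longrightarrow> \<forall>i\<in>players G. mono_on (typs G i) (fmax i)"
    using greatest_BNE_exists by blast
  obtain fmin where fmin: "least_in (BNE G) fmin"
    "own_type_single_crossing G \<Longrightarrow> \<forall>i\<in>players G. mono_on (typs G i) (fmin i)"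
    using least_BNE_exists by blast
  have BNE: "fmax \<in> BNE G" "fmin \<in> BNE G"
    using fmax(1) fmin(1) by (auto simp: greatest_in_def least_in_def)
  obtain L where L: "\<And>f i. f \<in> BNE G \<Longrightarrow> i \<in> players G \<Longrightarrow> L-lipschitz_on (typs G i) (f i)"
    using BNE_lipschitz by blast
  have lipschitz: "\<exists>L. \<forall>i\<in>players G. L-lipschitz_on (typs G i) (fmax i) \<and> L-lipschitz_on (typs G i) (fmin i)"
    using L BNE by blast
  have unique: "f = g"
    if "spectral_radius (map_mat complex_of_real (interaction_matrix G \<sigma> \<tau>)) < 1" "f \<in> BNE G" "g \<in> BNE G" for f g
    using that by (rule BNE_unique_if_spectral_radius_less_1)
  show ?thesis
    by (rule exI[of _ fmax], rule exI[of _ fmin])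
      (use fmax fmin lipschitz unique BNE in blast)
qed

end
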